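(* Let $1<p<2$. Let $E\subseteq\mathbb R$ be a closed set of (Lebesgue) measure zero. Suppose that $E$ has property $\mathrm{LP}(p)$. Then each portion $E\cap I$ of $E$ satisfies $$ |(E\cap I)_\delta|\le c\,|I|^{2/q}\,\delta^{1-2/q}, $$ where $1/p+1/q=1$ and the constant $c=c(p,E)>0$ is independent of $I$ and $\delta$.
   Context: Property $\mathrm{LP}(p)$. Let $E\subseteq\mathbb R$ be a closed set of Lebesgue measure zero, and let $I_k$, $k=1,2,\ldots$, be the intervals complementary to $E$, i.e. the connected components of $\mathbb R\setminus E$. Let $S_k$ be the operator defined by $\widehat{(S_kf)}=1_{I_k}\cdot\widehat f$ for $f\in L^2\cap L^p(\mathbb R)$, where $1_{I_k}$ is the characteristic function of $I_k$ and $\widehat{\ }$ stands for the Fourier transform. Put $S(f)=\left(\sum_k|S_kf|^2\right)^{1/2}$. For $1<p<\infty$, the set $E$ has property $\mathrm{LP}(p)$ if for all $f\in L^p(\mathbb R)$ one has $c_1\|f\|_{L^p(\mathbb R)}\le\|S(f)\|_{L^p(\mathbb R)}\le c_2\|f\|_{L^p(\mathbb R)}$, where $c_1,c_2$ are positive constants independent of $f$. Notation. A portion of a set $F\subseteq\mathbb R$ is a set of the form $F\cap I$, where $I$ is a bounded interval. For $F\subseteq\mathbb R$, $(F)_\delta$ denotes the open $\delta$-neighbourhood of $F$ ($\delta>0$), and $|F|$ denotes the Lebesgue measure of a measurable set $F$.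
   Formalization: The estimate is stated for 0 < δ ≤ |I| only; with unrestricted δ it is false, e.g. for E = {0} and I = [−1,1], where the left side is 2δ and the right side is of order δ^{1−2/q} as δ → ∞. *)

theory Defs
  imports "HOL-Analysis.Analysis"
begin

text \<open>
  \<open>L\<^sup>p(\<real>)\<close> consists of genuine (complex-valued, Borel) functions here, so operators that are only
  defined up to null sets are rendered as relations between a function and a representative
  of its image.
\<close>

definition Lp_space :: "real \<Rightarrow> (real \<Rightarrow> complex) set" where
  "Lp_space p = {f. f \<in> borel_measurable lborel \<and> integrable lborel (\<lambda>x. norm (f x) powr p)}"

definition Lp_norm :: "real \<Rightarrow> (real \<Rightarrow> complex) \<Rightarrow> real" where
  "Lp_norm p f = (LINT x|lborel. norm (f x) powr p) powr (1 / p)"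

definition Lp_tendsto :: "real \<Rightarrow> (nat \<Rightarrow> real \<Rightarrow> complex) \<Rightarrow> (real \<Rightarrow> complex) \<Rightarrow> bool" where
  "Lp_tendsto p u f \<longleftrightarrow> (\<forall>n. u n \<in> Lp_space p) \<and> f \<in> Lp_space p \<and>
     (\<lambda>n. Lp_norm p (\<lambda>x. u n x - f x)) \<longlonglongrightarrow> 0"

text \<open>
  The choice of normalisation does not matter: another one dilates the frequency axis (and
  multiplies the transform by a constant), and the Littlewood-Paley property below is
  invariant under dilations.
\<close>

definition fourier_L1 :: "(real \<Rightarrow> complex) \<Rightarrow> real \<Rightarrow> complex" where
  "fourier_L1 f \<xi> = (LINT x|lborel. f x * cis (- (\<xi> * x)))"

text \<open>
  \<open>fourier_L2 f h\<close>: \<open>h\<close> represents the Plancherel transform of \<open>f \<in> L\<^sup>2\<close>, that is, the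
  extension by continuity of the integral transform from \<open>L\<^sup>1 \<inter> L\<^sup>2\<close> to \<open>L\<^sup>2\<close>.
\<close>

definition fourier_L2 :: "(real \<Rightarrow> complex) \<Rightarrow> (real \<Rightarrow> complex) \<Rightarrow> bool" where
  "fourier_L2 f h \<longleftrightarrow>
     (\<exists>u. (\<forall>n. u n \<in> Lp_space 1 \<inter> Lp_space 2) \<and> Lp_tendsto 2 u f \<and>
          Lp_tendsto 2 (\<lambda>n. fourier_L1 (u n)) h)"

text \<open>\<open>freq_restrict J f g\<close>: for \<open>f, g \<in> L\<^sup>2\<close>, the transform of \<open>g\<close> is \<open>1\<^sub>J\<close> times that of \<open>f\<close>.\<close>

definition freq_restrict :: "real set \<Rightarrow> (real \<Rightarrow> complex) \<Rightarrow> (real \<Rightarrow> complex) \<Rightarrow> bool" where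
  "freq_restrict J f g \<longleftrightarrow>
     (\<exists>h. fourier_L2 f h \<and> fourier_L2 g (\<lambda>\<xi>. of_real (indicator J \<xi>) * h \<xi>))"

text \<open>
  \<open>freq_restrict_Lp p J f g\<close>: \<open>g\<close> represents the value at \<open>f \<in> L\<^sup>p\<close> of the extension by
  continuity of the preceding operator from \<open>L\<^sup>2 \<inter> L\<^sup>p\<close> to \<open>L\<^sup>p\<close>. For an interval \<open>J\<close> and
  \<open>1 < p < \<infinity>\<close> such a \<open>g\<close> exists and is unique up to null sets, by M. Riesz's theorem.
\<close>

definition freq_restrict_Lp ::
  "real \<Rightarrow> real set \<Rightarrow> (real \<Rightarrow> complex) \<Rightarrow> (real \<Rightarrow> complex) \<Rightarrow> bool" where
  "freq_restrict_Lp p J f g \<longleftrightarrow>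
     (\<exists>u v. (\<forall>n. u n \<in> Lp_space 2 \<inter> Lp_space p \<and> freq_restrict J (u n) (v n)) \<and>
            Lp_tendsto p u f \<and> Lp_tendsto p v g)"

text \<open>
  The complementary intervals serve as their own (countable) index set. A non-summable point
  gets the junk value 0 of \<open>infsum\<close>; the Littlewood-Paley property demands summability
  almost everywhere separately.
\<close>

definition square_function ::
  "real set \<Rightarrow> (real set \<Rightarrow> real \<Rightarrow> complex) \<Rightarrow> real \<Rightarrow> real" where
  "square_function E g x = sqrt (\<Sum>\<^sub>\<infinity>J\<in>components (- E). (norm (g J x))\<^sup>2)"

text \<open>
  Finiteness of the norm of the square function, implicit in the upper estimate, is explicit
  here because \<open>Lp_norm\<close> is real-valued. As each \<open>g J\<close> is determined by \<open>f\<close> up to null sets,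
  it is immaterial which representatives are taken.
\<close>

definition LP_property :: "real \<Rightarrow> real set \<Rightarrow> bool" where
  "LP_property p E \<longleftrightarrow>
     (\<exists>c1>0. \<exists>c2>0. \<forall>f\<in>Lp_space p. \<forall>g.
        (\<forall>J\<in>components (- E). freq_restrict_Lp p J f (g J)) \<longrightarrow>
          (AE x in lborel. (\<lambda>J. (norm (g J x))\<^sup>2) summable_on components (- E)) \<and>
          (\<lambda>x. of_real (square_function E g x)) \<in> Lp_space p \<and>
          c1 * Lp_norm p f \<le> Lp_norm p (\<lambda>x. of_real (square_function E g x)) \<and>
          Lp_norm p (\<lambda>x. of_real (square_function E g x)) \<le> c2 * Lp_norm p f)"

definition nbhd :: "real \<Rightarrow> real set \<Rightarrow> real set" where
  "nbhd \<delta> F = (\<Union>y\<in>F. ball y \<delta>)"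

end

theory Submission
  imports Defs "HOL-Probability.Characteristic_Functions"
begin

text \<open>
  Test the upper Littlewood-Paley estimate on the function \<open>f\<close> whose transform is a Gaussian of
  width \<open>L = |I|\<close> placed at \<open>I\<close>, so that \<open>\<parallel>f\<parallel>\<^sub>p\<close> is a multiple of \<open>L\<^bsup>1/q\<^esup>\<close>. If a complementary
  interval \<open>J \<subseteq> I\<close> has length at most \<open>t\<close>, then for \<open>|x| \<le> 1/t\<close> the integral defining
  \<open>S\<^sub>J f (x)\<close> has no cancellation, so that \<open>|S\<^sub>J f (x)| \<ge> \<kappa> |J|\<close>. Hence, for every \<open>t\<close>, the
  sum of \<open>|J|\<^sup>2\<close> over all such \<open>J\<close> is at most \<open>B L\<^bsup>2/q\<^esup> t\<^bsup>2/p\<^esup>\<close>. As \<open>1 < 2/p < 2\<close>, integrating this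
  against the weight \<open>t\<^bsup>-2\<^esup> min (1, \<delta>/t)\<close> bounds \<open>\<Sum> min (|J|, \<delta>)\<close>, which controls the measure of
  the neighbourhood because \<open>E\<close> is a null set.
\<close>

section \<open>Integrability of decaying functions\<close>

lemma integrable_powr_decay:
  fixes r :: real
  assumes "1 < r"
  shows "integrable lborel (\<lambda>x::real. (1 + \<bar>x\<bar>) powr (-r))"
proof -
  define h where "h = (\<lambda>x::real. (1 + \<bar>x\<bar>) powr (-r) * indicator {0..} x)"
  have "(\<integral>\<^sup>+x. ennreal ((1 + \<bar>x\<bar>) powr (-r)) * indicator {0..} x \<partial>lborel)
      = ennreal (0 - (1 + 0) powr (1 - r) / (1 - r))"
  proof (rule nn_integral_FTC_atLeast)
    show "((\<lambda>x. (1 + x) powr (1 - r) / (1 - r)) has_real_derivative (1 + \<bar>x\<bar>) powr (-r)) (at x)"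
      if "0 \<le> x" for x :: real
      using that assms by (auto intro!: derivative_eq_intros)
    show "((\<lambda>x::real. (1 + x) powr (1 - r) / (1 - r)) \<longlongrightarrow> 0) at_top"
    proof (rule tendsto_divide_zero)
      have "((\<lambda>x::real. (1 + x) powr - (r - 1)) \<longlongrightarrow> 0) at_top"
        using assms by (intro tendsto_neg_powr filterlim_tendsto_add_at_top[OF tendsto_const] filterlim_ident) auto
      then show "((\<lambda>x::real. (1 + x) powr (1 - r)) \<longlongrightarrow> 0) at_top" by simp
    qed
  qed auto
  then have h: "integrable lborel h"
    unfolding h_def
    by (intro integrableI_nonneg) (auto simp: ennreal_mult' ennreal_indicator)
  \<comment> \<open>The fundamental theorem of calculus covers the half-line only. Adding the
    reflection of \<open>h\<close> dominates the even function on the whole line, with equality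
    except at 0.\<close>
  have "integrable lborel (\<lambda>x. h x + h (0 + (-1) * x))"
    by (intro Bochner_Integration.integrable_add h lborel_integrable_real_affine) auto
  then show ?thesis
    by (rule Bochner_Integration.integrable_bound) (auto simp: h_def indicator_def)
qed

lemma integrable_inverse_1_plus_square_real: "integrable lborel (\<lambda>x::real. 1 / (1 + x\<^sup>2))"
proof (rule Bochner_Integration.integrable_bound)
  show "integrable lborel (\<lambda>x::real. 2 * (1 + \<bar>x\<bar>) powr (-2))"
    by (intro integrable_mult_right integrable_powr_decay) auto
  have "1 / (1 + x\<^sup>2) \<le> 2 * (1 + \<bar>x\<bar>) powr (-2)" for x :: real
  proof -
    have "(1 + \<bar>x\<bar>)\<^sup>2 \<le> 2 * (1 + x\<^sup>2)"
      using zero_le_power2[of "1 - \<bar>x\<bar>"] by (simp add: power2_eq_square algebra_simps)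
    moreover have pos: "0 < 1 + x\<^sup>2" "0 < (1 + \<bar>x\<bar>)\<^sup>2"
      by (auto simp: add_pos_nonneg)
    ultimately have "1 / (1 + x\<^sup>2) \<le> 2 / (1 + \<bar>x\<bar>)\<^sup>2"
      by (simp only: pos_divide_le_eq[OF pos(1)] times_divide_eq_left pos_le_divide_eq[OF pos(2)])
    then show ?thesis
      by (simp add: powr_minus_divide)
  qed
  then show "AE x in lborel. norm (1 / (1 + x\<^sup>2)) \<le> norm (2 * (1 + \<bar>x::real\<bar>) powr (-2))"
    by (auto simp: add_nonneg_nonneg)
qed auto

text \<open>Decay of order 1/|x| is what the jumps of a sharply truncated Gaussian allow for its
  inverse transform. It suffices for every exponent above 1, hence for both 2 and
  \<open>p\<close>.\<close>

lemma Lp_space_decay: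
  fixes g :: "real \<Rightarrow> complex"
  assumes [measurable]: "g \<in> borel_measurable borel" and g: "\<And>x. norm (g x) \<le> C / (1 + \<bar>x\<bar>)"
    and "1 < r"
  shows "g \<in> Lp_space r"
  unfolding Lp_space_def
proof (intro CollectI conjI)
  have C: "0 \<le> C" using order_trans[OF norm_ge_zero g[of 0]] by simp
  show "integrable lborel (\<lambda>x. norm (g x) powr r)"
  proof (rule Bochner_Integration.integrable_bound)
    show "integrable lborel (\<lambda>x::real. C powr r * (1 + \<bar>x\<bar>) powr (-r))"
      by (intro integrable_mult_right integrable_powr_decay assms)
    have "norm (g x) powr r \<le> C powr r * (1 + \<bar>x\<bar>) powr (-r)" for x
    proof -
      have "norm (g x) powr r \<le> (C / (1 + \<bar>x\<bar>)) powr r"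
        using assms by (intro powr_mono2) auto
      also have "\<dots> = C powr r * (1 + \<bar>x\<bar>) powr (-r)"
        using C by (simp add: powr_divide powr_minus_divide)
      finally show ?thesis .
    qed
    then show "AE x in lborel. norm (norm (g x) powr r) \<le> norm (C powr r * (1 + \<bar>x\<bar>) powr (-r))"
      by auto
  qed auto
qed auto

section \<open>Gaussian integrals and the inverse Fourier integral\<close>

lemma integrable_exp_neg_square:
  fixes N :: real
  assumes "0 < N"
  shows "integrable lborel (\<lambda>x. exp (- (x / N)\<^sup>2 / 2))"
proof -
  have "integrable lborel (\<lambda>x. sqrt (2 * pi) * N * normal_density 0 N x)"
    using assms by (intro integrable_mult_right integrable_normal_density)
  then show ?thesis
    using assms by (simp add: normal_density_def real_sqrt_mult power_divide mult.commute)
qed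

text \<open>For \<open>N = 1\<close> this is the characteristic function of the standard normal
  distribution; a dilation gives the rest.\<close>

lemma integral_gauss_cis:
  fixes N t :: real
  assumes "0 < N"
  shows "(LINT x|lborel. of_real (exp (- (x / N)\<^sup>2 / 2)) * cis (t * x))
    = of_real (N * sqrt (2 * pi) * exp (- (t * N)\<^sup>2 / 2))"
proof -
  have std: "(LINT x|lborel. of_real (exp (- x\<^sup>2 / 2)) * cis (s * x))
      = complex_of_real (sqrt (2 * pi) * exp (- s\<^sup>2 / 2))" for s :: real
  proof -
    have "complex_of_real (exp (- s\<^sup>2 / 2)) = char std_normal_distribution s"
      by (simp add: char_std_normal_distribution)
    also have "\<dots> = (LINT x|lborel. std_normal_density x *\<^sub>R cis (s * x))"
      unfolding char_def by (subst integral_density) (auto simp: cis_conv_exp)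
    also have "\<dots> = (LINT x|lborel. of_real (1 / sqrt (2 * pi)) * (of_real (exp (- x\<^sup>2 / 2)) * cis (s * x)))"
      by (intro Bochner_Integration.integral_cong) (auto simp: std_normal_density_def scaleR_conv_of_real)
    also have "\<dots> = of_real (1 / sqrt (2 * pi)) * (LINT x|lborel. of_real (exp (- x\<^sup>2 / 2)) * cis (s * x))"
      by (rule integral_mult_right_zero)
    finally show ?thesis by (simp add: field_simps)
  qed
  have "(LINT x|lborel. of_real (exp (- (x / N)\<^sup>2 / 2)) * cis (t * x))
     = \<bar>N\<bar> *\<^sub>R (LINT x|lborel. complex_of_real (exp (- ((0 + N * x) / N)\<^sup>2 / 2)) * cis (t * (0 + N * x)))"
    using assms by (intro lborel_integral_real_affine) auto
  also have "\<dots> = N *\<^sub>R (LINT x|lborel. of_real (exp (- x\<^sup>2 / 2)) * cis ((t * N) * x))"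
    using assms by (simp add: mult.assoc)
  also have "\<dots> = of_real (N * sqrt (2 * pi) * exp (- (t * N)\<^sup>2 / 2))"
    unfolding std by (simp add: scaleR_conv_of_real mult.assoc)
  finally show ?thesis .
qed

text \<open>The factor \<open>1 / (2 * pi)\<close> matches the unnormalised kernel of
  \<open>fourier_L1\<close>, so that the two integrals are formally inverse to each other.\<close>

definition inv_fourier :: "(real \<Rightarrow> complex) \<Rightarrow> real \<Rightarrow> complex" where
  "inv_fourier K x = of_real (1 / (2 * pi)) * (LINT \<xi>|lborel. K \<xi> * cis (x * \<xi>))"

lemma borel_measurable_cis [measurable]: "cis \<in> borel_measurable borel"
  by (intro borel_measurable_continuous_onI continuous_intros)

lemma borel_measurable_inv_fourier [measurable]:
  assumes [measurable]: "K \<in> borel_measurable borel"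
  shows "inv_fourier K \<in> borel_measurable borel"
  unfolding inv_fourier_def[abs_def] by measurable

text \<open>A Gaussian cutoff in space is a Gaussian average in frequency. The cutoff makes the
  double integral absolutely convergent, so Fubini applies even if \<open>inv_fourier K\<close> is
  not integrable.\<close>

lemma inv_fourier_gauss_mult_integral:
  assumes [measurable]: "K \<in> borel_measurable borel" and K: "integrable lborel K" and N: "0 < (N::real)"
  shows "fourier_L1 (\<lambda>x. inv_fourier K x * of_real (exp (- (x / N)\<^sup>2 / 2))) \<xi>
    = (LINT s|lborel. of_real (std_normal_density s) * K (\<xi> + (1 / N) * s))"
proof -
  let ?G = "\<lambda>x. exp (- (x / N)\<^sup>2 / 2)"
  let ?F = "\<lambda>x \<eta>. K \<eta> * (of_real (?G x) * cis ((\<eta> - \<xi>) * x))"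
  have G: "integrable lborel ?G" using N by (rule integrable_exp_neg_square)
  have int: "integrable (lborel \<Otimes>\<^sub>M lborel) (\<lambda>(x, \<eta>). ?F x \<eta>)"
  proof (rule lborel_pair.Fubini_integrable)
    have "integrable lborel (\<lambda>x. (LINT \<eta>|lborel. norm (K \<eta>)) * ?G x)"
      using G by (rule integrable_mult_right)
    then show "integrable lborel (\<lambda>x. LINT \<eta>|lborel. norm (case (x, \<eta>) of (x, \<eta>) \<Rightarrow> ?F x \<eta>))"
      by (simp add: norm_mult)
    have "integrable lborel (?F x)" for x
      by (rule Bochner_Integration.integrable_bound[of _ "\<lambda>\<eta>. ?G x *\<^sub>R K \<eta>"])
         (use K in \<open>auto simp: norm_mult mult.commute\<close>)
    then show "AE x in lborel. integrable lborel (\<lambda>y. case (x, y) of (x, \<eta>) \<Rightarrow> ?F x \<eta>)" by simp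
  qed measurable
  have "fourier_L1 (\<lambda>x. inv_fourier K x * of_real (?G x)) \<xi>
     = (LINT x|lborel. of_real (1 / (2 * pi)) * (LINT \<eta>|lborel. ?F x \<eta>))"
    unfolding fourier_L1_def
  proof (intro Bochner_Integration.integral_cong refl)
    fix x :: real
    have "(LINT \<eta>|lborel. K \<eta> * cis (x * \<eta>)) * (of_real (?G x) * cis (- (\<xi> * x)))
      = (LINT \<eta>|lborel. K \<eta> * cis (x * \<eta>) * (of_real (?G x) * cis (- (\<xi> * x))))"
      by (rule integral_mult_left_zero[symmetric])
    also have "\<dots> = (LINT \<eta>|lborel. ?F x \<eta>)"
    proof (intro Bochner_Integration.integral_cong refl)
      fix \<eta>
      have "cis (x * \<eta>) * cis (- (\<xi> * x)) = cis ((\<eta> - \<xi>) * x)"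
        by (simp add: cis_mult algebra_simps)
      then show "K \<eta> * cis (x * \<eta>) * (of_real (?G x) * cis (- (\<xi> * x))) = ?F x \<eta>"
        by (simp add: mult_ac)
    qed
    finally show "inv_fourier K x * of_real (?G x) * cis (- (\<xi> * x))
      = of_real (1 / (2 * pi)) * (LINT \<eta>|lborel. ?F x \<eta>)"
      by (simp add: inv_fourier_def mult.assoc)
  qed
  also have "\<dots> = of_real (1 / (2 * pi)) * (LINT x|lborel. LINT \<eta>|lborel. ?F x \<eta>)"
    by simp
  also have "(LINT x|lborel. LINT \<eta>|lborel. ?F x \<eta>) = (LINT \<eta>|lborel. LINT x|lborel. ?F x \<eta>)"
    using lborel_pair.Fubini_integral[OF int] ..
  also have "\<dots> = (LINT \<eta>|lborel. K \<eta> * of_real (N * sqrt (2 * pi) * exp (- ((\<eta> - \<xi>) * N)\<^sup>2 / 2)))"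
    by (simp only: integral_mult_right_zero integral_gauss_cis[OF N])
  \<comment> \<open>Substituting \<open>\<eta> = \<xi> + s / N\<close> moves the dependence on
    \<open>N\<close> from the kernel into the argument of \<open>K\<close>, which leaves a fixed
    probability weight for dominated convergence.\<close>
  also have "\<dots> = \<bar>1 / N\<bar> *\<^sub>R (LINT s|lborel. K (\<xi> + (1 / N) * s) *
      of_real (N * sqrt (2 * pi) * exp (- ((\<xi> + (1 / N) * s - \<xi>) * N)\<^sup>2 / 2)))"
    using N by (intro lborel_integral_real_affine) auto
  also have "\<dots> = (LINT s|lborel. \<bar>1 / N\<bar> *\<^sub>R (K (\<xi> + (1 / N) * s) *
      of_real (N * sqrt (2 * pi) * exp (- ((\<xi> + (1 / N) * s - \<xi>) * N)\<^sup>2 / 2))))"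
    by (rule integral_scaleR_right[symmetric]) 
  also have "of_real (1 / (2 * pi)) * \<dots> = (LINT s|lborel. of_real (1 / (2 * pi)) * (\<bar>1 / N\<bar> *\<^sub>R (K (\<xi> + (1 / N) * s) *
      of_real (N * sqrt (2 * pi) * exp (- ((\<xi> + (1 / N) * s - \<xi>) * N)\<^sup>2 / 2)))))"
    by (rule integral_mult_right_zero[symmetric])
  also have "\<dots> = (LINT s|lborel. of_real (std_normal_density s) * K (\<xi> + (1 / N) * s))"
  proof (intro Bochner_Integration.integral_cong refl)
    fix s :: real
    have "1 / (2 * pi) * ((1 / N) * (N * sqrt (2 * pi) * exp (- ((\<xi> + (1 / N) * s - \<xi>) * N)\<^sup>2 / 2))) 
      = std_normal_density s"
    proof -
      have "sqrt (2 * pi) / (2 * pi) = 1 / sqrt (2 * pi)"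
        by (simp add: field_simps flip: real_sqrt_mult)
      from arg_cong[OF this, of "\<lambda>t. t * exp (- (s\<^sup>2 / 2))"]
      show ?thesis using N by (simp add: std_normal_density_def)
    qed
    from arg_cong[OF this, of complex_of_real]
    show "of_real (1 / (2 * pi)) * (\<bar>1 / N\<bar> *\<^sub>R (K (\<xi> + (1 / N) * s) *
      of_real (N * sqrt (2 * pi) * exp (- ((\<xi> + (1 / N) * s - \<xi>) * N)\<^sup>2 / 2))))
      = of_real (std_normal_density s) * K (\<xi> + (1 / N) * s)"
      using N by (simp add: scaleR_conv_of_real mult_ac)
  qed
  finally show ?thesis .
qed

section \<open>Plancherel transforms by Gaussian summation\<close>

lemma Lp_tendsto_dominated:
  assumes p: "0 < p" and u: "\<And>n. u n \<in> Lp_space p" and f: "f \<in> Lp_space p"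
    and lim: "AE x in lborel. (\<lambda>n. u n x) \<longlonglongrightarrow> f x"
    and bound: "\<And>n x. norm (u n x - f x) \<le> w x" and w: "integrable lborel (\<lambda>x. w x powr p)"
  shows "Lp_tendsto p u f"
proof -
  have [measurable]: "u n \<in> borel_measurable borel" "f \<in> borel_measurable borel" for n
    using u f by (auto simp: Lp_space_def)
  have "(\<lambda>n. LINT x|lborel. norm (u n x - f x) powr p) \<longlonglongrightarrow> (LINT (x::real)|lborel. 0)"
  proof (rule integral_dominated_convergence[OF _ _ w])
    show "AE x in lborel. (\<lambda>n. norm (u n x - f x) powr p) \<longlonglongrightarrow> 0"
      using lim
    proof eventually_elim
      case (elim x)
      then have "(\<lambda>n. norm (u n x - f x)) \<longlonglongrightarrow> 0"
        by (intro tendsto_norm_zero LIM_zero)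
      from tendsto_powr'[OF this tendsto_const[of p]] p
      show ?case by simp
    qed
    show "AE x in lborel. norm (norm (u n x - f x) powr p) \<le> w x powr p" for n
      using bound p by (auto intro!: powr_mono2)
  qed measurable
  then have "(\<lambda>n. LINT x|lborel. norm (u n x - f x) powr p) \<longlonglongrightarrow> 0" by simp
  from tendsto_powr'[OF this tendsto_const[of "1 / p"]] p
  have "(\<lambda>n. Lp_norm p (\<lambda>x. u n x - f x)) \<longlonglongrightarrow> 0"
    unfolding Lp_norm_def by (simp add: Bochner_Integration.integral_nonneg)
  then show ?thesis using u f by (auto simp: Lp_tendsto_def)
qed

text \<open>Shifting the argument costs only a factor polynomial in the shift \<open>t\<close>,
  which is integrable against a Gaussian density. Hence Gaussian averages inherit quadratic
  decay.\<close>

lemma peetre_inequality: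
  fixes \<xi> t :: real
  shows "1 / (1 + (\<xi> + t)\<^sup>2) \<le> 2 * (1 + t\<^sup>2) / (1 + \<xi>\<^sup>2)"
proof -
  \<comment> \<open>This expression is the right side minus the left side of the next
    inequality.\<close>
  have "0 \<le> (\<xi> + 2 * t)\<^sup>2 + 1 + 2 * (t * (\<xi> + t))\<^sup>2" by (intro add_nonneg_nonneg) auto
  then have "1 + \<xi>\<^sup>2 \<le> 2 * (1 + t\<^sup>2) * (1 + (\<xi> + t)\<^sup>2)"
    by (simp add: power2_eq_square algebra_simps)
  moreover have pos: "0 < 1 + (\<xi> + t)\<^sup>2" "0 < 1 + \<xi>\<^sup>2" by (auto simp: add_pos_nonneg)
  ultimately show ?thesis
    by (simp only: pos_divide_le_eq[OF pos(1)] times_divide_eq_left pos_le_divide_eq[OF pos(2)])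
       simp
qed

lemma integrable_of_quadratic_decay:
  fixes K :: "real \<Rightarrow> complex"
  assumes [measurable]: "K \<in> borel_measurable borel" and bound: "\<And>\<xi>. norm (K \<xi>) \<le> C / (1 + \<xi>\<^sup>2)"
  shows "integrable lborel K"
proof (rule Bochner_Integration.integrable_bound)
  show "integrable lborel (\<lambda>\<xi>. C * (1 / (1 + \<xi>\<^sup>2)))"
    by (intro integrable_mult_right integrable_inverse_1_plus_square_real)
  show "AE \<xi> in lborel. norm (K \<xi>) \<le> norm (C * (1 / (1 + \<xi>\<^sup>2)))"
    by (intro AE_I2 order_trans[OF bound]) (auto intro!: divide_right_mono)
qed simp

lemma Lp_space_2_quadratic_decay:
  fixes K :: "real \<Rightarrow> complex"
  assumes "K \<in> borel_measurable borel" and bound: "\<And>\<xi>. norm (K \<xi>) \<le> C / (1 + \<xi>\<^sup>2)"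
  shows "K \<in> Lp_space 2"
proof (rule Lp_space_decay)
  have C: "0 \<le> C" using order_trans[OF norm_ge_zero bound[of 0]] by simp
  show "norm (K \<xi>) \<le> 2 * C / (1 + \<bar>\<xi>\<bar>)" for \<xi>
  proof -
    have "0 \<le> (1 - \<bar>\<xi>\<bar>)\<^sup>2 + \<xi>\<^sup>2" by (intro add_nonneg_nonneg) auto
    then have "1 + \<bar>\<xi>\<bar> \<le> 2 * (1 + \<xi>\<^sup>2)"
      by (simp add: power2_eq_square algebra_simps)
    then have "1 / (1 + \<xi>\<^sup>2) \<le> 2 / (1 + \<bar>\<xi>\<bar>)"
      using add_pos_nonneg[of 1 "\<xi>\<^sup>2"]
      by (simp only: pos_divide_le_eq times_divide_eq_left pos_le_divide_eq) 
         (simp add: field_simps add_pos_nonneg)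
    from mult_left_mono[OF this C] show ?thesis
      using order_trans[OF bound[of \<xi>]] by (simp add: mult.commute)
  qed
qed (use assms in auto)

text \<open>The sequence required by \<open>fourier_L2\<close> consists of Gaussian cutoffs
  \<open>u n\<close> of \<open>inv_fourier K\<close>. Their transforms \<open>v n\<close> are
  averages of \<open>K\<close> at scale \<open>1 / N n\<close> and tend to \<open>K\<close> at its
  continuity points. Both limits in the square norm follow by dominated convergence, with
  \<open>inv_fourier K\<close> and the quadratic decay of \<open>K\<close> as the sources of the
  majorants.\<close>

lemma fourier_L2_inv_fourier:
  assumes [measurable]: "K \<in> borel_measurable borel" and bound: "\<And>\<xi>. norm (K \<xi>) \<le> C / (1 + \<xi>\<^sup>2)"
    and cont: "AE \<xi> in lborel. isCont K \<xi>" and L2: "inv_fourier K \<in> Lp_space 2"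
  shows "fourier_L2 (inv_fourier K) K"
proof -
  define N where "N n = real (Suc n)" for n
  have N: "1 \<le> N n" "0 < N n" for n by (auto simp: N_def)
  have Ninf: "(\<lambda>n. t / N n) \<longlonglongrightarrow> 0" for t
    unfolding N_def by (rule LIMSEQ_Suc) (rule lim_const_over_n)
  define G where "G n x = exp (- (x / N n)\<^sup>2 / 2)" for n and x :: real
  define u where "u n x = inv_fourier K x * of_real (G n x)" for n x
  have C: "0 \<le> C" using order_trans[OF norm_ge_zero bound[of 0]] by simp
  have K: "integrable lborel K" by (rule integrable_of_quadratic_decay) fact+
  have [measurable]: "G n \<in> borel_measurable borel" "u n \<in> borel_measurable borel" for n
    unfolding u_def[abs_def] G_def[abs_def] by measurable
  have G: "0 < G n x" "G n x \<le> 1" for n x by (auto simp: G_def)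
  have u_le: "norm (u n x) \<le> norm (inv_fourier K x)" for n x
    unfolding u_def norm_mult using G[of n x] by (simp add: mult_left_le)
  have L2': "integrable lborel (\<lambda>x. norm (inv_fourier K x) powr 2)"
    using L2 by (simp add: Lp_space_def)
  have u2: "u n \<in> Lp_space 2" for n
    unfolding Lp_space_def
    by (intro CollectI conjI Bochner_Integration.integrable_bound[OF L2'])
       (auto intro!: powr_mono2 u_le)
  have intG: "integrable lborel (G n)" for n
    unfolding G_def[abs_def] using N(2) by (rule integrable_exp_neg_square)
  have K_le: "norm (K \<xi>) \<le> C" for \<xi>
    by (rule order_trans[OF bound]) (use C in \<open>simp add: pos_divide_le_eq add_pos_nonneg mult_right_le_one_le algebra_simps\<close>)
  \<comment> \<open>Boundedness of \<open>inv_fourier K\<close> makes its product with the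
    integrable Gaussian integrable.\<close>
  have bdd: "norm (inv_fourier K x) \<le> 1 / (2 * pi) * (LINT \<xi>|lborel. norm (K \<xi>))" for x
    unfolding inv_fourier_def norm_mult
    by (intro mult_mono order_trans[OF integral_norm_bound]) (auto simp: norm_mult norm_divide)
  have u1: "u n \<in> Lp_space 1" for n
  proof -
    have "integrable lborel (\<lambda>x. 1 / (2 * pi) * (LINT \<xi>|lborel. norm (K \<xi>)) * G n x)"
      by (intro integrable_mult_right intG)
    then have "integrable lborel (\<lambda>x. norm (u n x))"
    proof (rule Bochner_Integration.integrable_bound)
      show "AE x in lborel. norm (norm (u n x)) \<le> norm (1 / (2 * pi) * (LINT \<xi>|lborel. norm (K \<xi>)) * G n x)"
        using mult_right_mono[OF bdd less_imp_le[OF G(1)]] G(1)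
        by (intro AE_I2) (simp add: u_def norm_mult abs_mult less_imp_le)
    qed auto
    then show ?thesis by (auto simp: Lp_space_def)
  qed
  have u_lim: "Lp_tendsto 2 u (inv_fourier K)"
  proof (rule Lp_tendsto_dominated[OF _ u2 L2 _ _ L2'])
    have "(\<lambda>n. u n x) \<longlonglongrightarrow> inv_fourier K x * of_real (exp (- 0\<^sup>2 / 2))" for x
      unfolding u_def G_def by (intro tendsto_intros Ninf) auto
    then show "AE x in lborel. (\<lambda>n. u n x) \<longlonglongrightarrow> inv_fourier K x" by simp
    show "norm (u n x - inv_fourier K x) \<le> norm (inv_fourier K x)" for n x
    proof -
      have "u n x - inv_fourier K x = inv_fourier K x * of_real (G n x - 1)"
        by (simp add: u_def algebra_simps)
      moreover have "\<bar>G n x - 1\<bar> \<le> 1" using G[of n x] by auto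
      ultimately show ?thesis by (simp only: norm_mult norm_of_real) (simp add: mult_left_le)
    qed
  qed simp
  define v where "v n \<xi> = (LINT s|lborel. of_real (std_normal_density s) * K (\<xi> + (1 / N n) * s))" for n \<xi>
  have Fu: "fourier_L1 (u n) = v n" for n
    unfolding u_def G_def v_def
    by (intro ext inv_fourier_gauss_mult_integral K N) auto
  have [measurable]: "v n \<in> borel_measurable borel" for n
    unfolding v_def[abs_def] by measurable
  have v_le: "norm (v n \<xi>) \<le> 4 * C / (1 + \<xi>\<^sup>2)" for n \<xi>
  proof -
    \<comment> \<open>Peetre's inequality leaves the factor \<open>1 + s\<^sup>2\<close>. The normal
      moments of order 0 and 2 are both 1, which turns \<open>2 * C\<close> into
      \<open>4 * C\<close>.\<close>
    have "integrable lborel (\<lambda>s. std_normal_density s * s ^ 0 + std_normal_density s * s ^ 2)"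
      by (intro Bochner_Integration.integrable_add integrable_std_normal_moment)
    then have int: "integrable lborel (\<lambda>s. 2 * C / (1 + \<xi>\<^sup>2) * (std_normal_density s * s ^ 0 + std_normal_density s * s ^ 2))"
      by (rule integrable_mult_right)
    have "norm (v n \<xi>) \<le> (LINT s|lborel. 2 * C / (1 + \<xi>\<^sup>2) * (std_normal_density s * s ^ 0 + std_normal_density s * s ^ 2))"
      unfolding v_def
    proof (rule Bochner_Integration.integral_norm_bound_integral[OF _ int])
      show le: "norm (complex_of_real (std_normal_density s) * K (\<xi> + (1 / N n) * s))
         \<le> 2 * C / (1 + \<xi>\<^sup>2) * (std_normal_density s * s ^ 0 + std_normal_density s * s ^ 2)" for s
      proof -
        have "norm (K (\<xi> + (1 / N n) * s)) \<le> C * (1 / (1 + (\<xi> + (1 / N n) * s)\<^sup>2))"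
          using bound[of "\<xi> + (1 / N n) * s"] by simp
        also have "\<dots> \<le> C * (2 * (1 + ((1 / N n) * s)\<^sup>2) / (1 + \<xi>\<^sup>2))"
          by (intro mult_left_mono peetre_inequality C)
        also have "((1 / N n) * s)\<^sup>2 \<le> s\<^sup>2"
          using N(1)[of n] by (simp add: power_divide divide_le_eq mult_left_le_one_le)
             (metis N(2) mult_right_mono mult_1 one_le_power zero_le_power2 mult.commute)
        then have "C * (2 * (1 + ((1 / N n) * s)\<^sup>2) / (1 + \<xi>\<^sup>2)) \<le> C * (2 * (1 + s\<^sup>2) / (1 + \<xi>\<^sup>2))"
          by (intro mult_left_mono divide_right_mono C) auto
        finally have "norm (K (\<xi> + (1 / N n) * s)) \<le> C * (2 * (1 + s\<^sup>2) / (1 + \<xi>\<^sup>2))" .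
        from mult_left_mono[OF this normal_density_nonneg[of 0 1 s]] show ?thesis
          by (simp add: norm_mult algebra_simps add_divide_distrib)
      qed
      show "integrable lborel (\<lambda>s. complex_of_real (std_normal_density s) * K (\<xi> + (1 / N n) * s))"
        by (rule Bochner_Integration.integrable_bound[OF int])
           (use le C in \<open>auto intro!: AE_I2 order_trans[OF le]\<close>)
    qed
    also have "\<dots> = 2 * C / (1 + \<xi>\<^sup>2) * ((LINT s|lborel. std_normal_density s * s ^ 0) + (LINT s|lborel. std_normal_density s * s ^ 2))"
      by (subst integral_mult_right_zero, subst Bochner_Integration.integral_add)
         (intro refl integrable_std_normal_moment)+
    also have "\<dots> = 4 * C / (1 + \<xi>\<^sup>2)"
      using integral_std_normal_moment_even[of 1] by (simp add: fact_numeral)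
    finally show ?thesis .
  qed
  have v_lim: "Lp_tendsto 2 v K"
  proof (rule Lp_tendsto_dominated)
    show "v n \<in> Lp_space 2" for n by (rule Lp_space_2_quadratic_decay[OF _ v_le]) auto
    show K2: "K \<in> Lp_space 2" by (rule Lp_space_2_quadratic_decay[OF _ bound]) auto
    \<comment> \<open>The majorant adds the bounds for \<open>v n\<close> and \<open>K\<close>. It
      is written as the norm of a complex function so that its square integrability is again an
      instance of quadratic decay.\<close>
    show "norm (v n \<xi> - K \<xi>) \<le> norm (complex_of_real (5 * C / (1 + \<xi>\<^sup>2)))" for n \<xi>
    proof -
      have "norm (v n \<xi> - K \<xi>) \<le> 4 * C / (1 + \<xi>\<^sup>2) + C / (1 + \<xi>\<^sup>2)"
        by (intro order_trans[OF norm_triangle_ineq4] add_mono v_le bound)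
      also have "\<dots> = 5 * C / (1 + \<xi>\<^sup>2)" by (simp add: field_simps)
      finally show ?thesis using C unfolding norm_of_real by (simp add: abs_of_nonneg)
    qed
    have "(\<lambda>\<xi>. complex_of_real (5 * C / (1 + \<xi>\<^sup>2))) \<in> Lp_space 2"
    proof (rule Lp_space_2_quadratic_decay[where C="5 * C"])
      show "norm (complex_of_real (5 * C / (1 + \<xi>\<^sup>2))) \<le> 5 * C / (1 + \<xi>\<^sup>2)" for \<xi>
        using C unfolding norm_of_real by (simp add: abs_of_nonneg)
    qed measurable
    then show "integrable lborel (\<lambda>\<xi>. norm (complex_of_real (5 * C / (1 + \<xi>\<^sup>2))) powr 2)"
      by (simp add: Lp_space_def)
    show "AE \<xi> in lborel. (\<lambda>n. v n \<xi>) \<longlonglongrightarrow> K \<xi>"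
      using cont
    proof eventually_elim
      case (elim \<xi>)
      have "(\<lambda>n. v n \<xi>) \<longlonglongrightarrow> (LINT s|lborel. of_real (std_normal_density s) * K \<xi>)"
        unfolding v_def
      proof (rule integral_dominated_convergence)
        show "integrable lborel (\<lambda>s. C * std_normal_density s)"
          by (intro integrable_mult_right) auto
        have "(\<lambda>n. K (\<xi> + (1 / N n) * s)) \<longlonglongrightarrow> K \<xi>" for s
          using tendsto_add[OF tendsto_const[of \<xi>] Ninf[of s]]
          by (intro isCont_tendsto_compose[OF elim]) simp
        then show "AE s in lborel. (\<lambda>n. complex_of_real (std_normal_density s) * K (\<xi> + (1 / N n) * s))
            \<longlonglongrightarrow> of_real (std_normal_density s) * K \<xi>"
          by (intro AE_I2 tendsto_intros) auto
        show "AE s in lborel. norm (complex_of_real (std_normal_density s) * K (\<xi> + (1 / N n) * s))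
            \<le> C * std_normal_density s" for n
          using mult_left_mono[OF K_le normal_density_nonneg]
          by (intro AE_I2) (simp add: norm_mult mult.commute[of C])
      qed measurable
      also have "(LINT s|lborel. of_real (std_normal_density s) * K \<xi>) = K \<xi>"
        by simp
      finally show ?case .
    qed
  qed simp
  show ?thesis
    unfolding fourier_L2_def using u1 u2 u_lim v_lim by (intro exI[of _ u]) (auto simp: Fu)
qed

section \<open>Frequency bands of a Gaussian\<close>

lemma open_connected_bounded_real:
  fixes S :: "real set"
  assumes "open S" "connected S" "bounded S" "S \<noteq> {}"
  obtains c d where "c < d" "S = {c<..<d}"
proof -
  have "connected (closure S) \<and> compact (closure S)"
    using assms by (simp add: connected_imp_connected_closure)
  then obtain c d where "closure S = {c..d}"
    unfolding connected_compact_interval_1 by auto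
  then have "S = {c<..<d}"
    using assms convex_interior_closure[of S] convex_connected[of S]
    by (metis connected_convex_1 interior_atLeastAtMost_real interior_open)
  moreover from this assms(4) have "c < d" by auto
  ultimately show ?thesis using that by blast
qed

text \<open>The peak has height 1 and sits at the left end of \<open>{a..a + L}\<close>; on that
  interval the values stay above \<open>exp (- 1 / 2)\<close>.\<close>

definition gauss :: "real \<Rightarrow> real \<Rightarrow> real \<Rightarrow> real" where
  "gauss a L \<xi> = exp (- ((\<xi> - a) / L)\<^sup>2 / 2)"

text \<open>For the test function \<open>f\<close> with transform \<open>band a L UNIV\<close>, this
  is the transform of \<open>S\<^sub>J f\<close>.\<close>

definition band :: "real \<Rightarrow> real \<Rightarrow> real set \<Rightarrow> real \<Rightarrow> complex" where
  "band a L J \<xi> = of_real (indicator J \<xi>) * of_real (gauss a L \<xi>)"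

lemma gauss_pos: "0 < gauss a L \<xi>" and gauss_le_1: "gauss a L \<xi> \<le> 1"
  by (auto simp: gauss_def)

lemma borel_measurable_gauss [measurable]: "gauss a L \<in> borel_measurable borel"
  unfolding gauss_def[abs_def] by measurable

lemma borel_measurable_band [measurable]:
  assumes [measurable]: "J \<in> sets borel"
  shows "band a L J \<in> borel_measurable borel"
  unfolding band_def[abs_def] by measurable

text \<open>With \<open>v\<close> the negated exponent of the Gaussian,
  \<open>1 + \<xi>\<^sup>2\<close> is at most the constant times \<open>1 + v\<close>, and
  \<open>1 + v \<le> exp v\<close>.\<close>

lemma gauss_quadratic_decay:
  assumes "0 < L"
  shows "gauss a L \<xi> \<le> (1 + 2 * a\<^sup>2 + 4 * L\<^sup>2) / (1 + \<xi>\<^sup>2)"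
proof -
  define v where "v = ((\<xi> - a) / L)\<^sup>2 / 2"
  have v: "0 \<le> v" "4 * L\<^sup>2 * v = 2 * (\<xi> - a)\<^sup>2"
    using assms by (auto simp: v_def power_divide)
  have "0 \<le> (\<xi> - 2 * a)\<^sup>2" by simp
  then have "1 + \<xi>\<^sup>2 \<le> 1 + 2 * a\<^sup>2 + 2 * (\<xi> - a)\<^sup>2"
    by (simp add: power2_eq_square algebra_simps)
  also have "\<dots> \<le> (1 + 2 * a\<^sup>2 + 4 * L\<^sup>2) * (1 + v)"
  proof -
    have "(1 + 2 * a\<^sup>2 + 4 * L\<^sup>2) * (1 + v)
        = 1 + 2 * a\<^sup>2 + 4 * L\<^sup>2 * v + (v + 2 * a\<^sup>2 * v + 4 * L\<^sup>2)"
      by (simp add: algebra_simps)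
    then show ?thesis using v by simp
  qed
  also have "\<dots> \<le> (1 + 2 * a\<^sup>2 + 4 * L\<^sup>2) * exp v"
    by (intro mult_left_mono exp_ge_add_one_self) (auto simp: add_nonneg_nonneg)
  finally have "(1 + \<xi>\<^sup>2) * exp (- v) \<le> 1 + 2 * a\<^sup>2 + 4 * L\<^sup>2"
    by (simp add: exp_minus field_simps)
  then have "exp (- v) \<le> (1 + 2 * a\<^sup>2 + 4 * L\<^sup>2) / (1 + \<xi>\<^sup>2)"
    by (simp add: pos_le_divide_eq add_pos_nonneg mult.commute)
  then show ?thesis by (simp add: gauss_def v_def)
qed

lemma norm_band_le_gauss: "norm (band a L J \<xi>) \<le> gauss a L \<xi>"
  by (auto simp: band_def indicator_def gauss_pos less_imp_le)

lemma band_quadratic_decay: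
  assumes "0 < L"
  shows "norm (band a L J \<xi>) \<le> (1 + 2 * a\<^sup>2 + 4 * L\<^sup>2) / (1 + \<xi>\<^sup>2)"
  using norm_band_le_gauss gauss_quadratic_decay[OF assms] by (rule order_trans)

lemma integrable_gauss_moment:
  assumes "0 < L"
  shows "integrable lborel (\<lambda>\<xi>. gauss a L \<xi> * \<bar>\<xi> - a\<bar> ^ k)"
proof -
  have "integrable lborel (\<lambda>x. sqrt (2 * pi) * L * (normal_density a L x * \<bar>x - a\<bar> ^ k))"
    using assms by (intro integrable_mult_right integrable_normal_moment_abs)
  then show ?thesis
    using assms by (simp add: gauss_def normal_density_def real_sqrt_mult power_divide mult.commute)
qed

lemma integrable_gauss: "0 < L \<Longrightarrow> integrable lborel (gauss a L)"
  using integrable_gauss_moment[of L a 0] by simp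

lemma integrable_band:
  assumes "0 < L" "J \<in> sets borel"
  shows "integrable lborel (\<lambda>\<xi>. band a L J \<xi> * cis (x * \<xi>))"
  by (rule Bochner_Integration.integrable_bound[OF integrable_gauss[OF assms(1), of a]])
     (use assms norm_band_le_gauss[of a L J] gauss_pos[of a L] in
       \<open>auto simp: norm_mult less_imp_le\<close>)

text \<open>Integration by parts gains the factor \<open>x\<close>. Each boundary term has modulus
  at most 1, and the derivative of the Gaussian is integrated in modulus over the whole line, so the
  bound is independent of \<open>c\<close> and \<open>d\<close>.\<close>

lemma band_integral_by_parts:
  assumes L: "0 < L" and "c \<le> d"
  shows "\<bar>x\<bar> * norm (LINT \<xi>|lborel. band a L {c..d} \<xi> * cis (x * \<xi>))
    \<le> 2 + (LINT \<xi>|lborel. gauss a L \<xi> * \<bar>\<xi> - a\<bar>) / L\<^sup>2"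
proof -
  define H where "H \<xi> = of_real (gauss a L \<xi>) * cis (x * \<xi>)" for \<xi>
  define D where "D \<xi> = - complex_of_real ((\<xi> - a) / L\<^sup>2) * H \<xi>" for \<xi>
  \<comment> \<open>As the exponential of a complex polynomial, \<open>H\<close> can be
    differentiated in a complex variable and then restricted to the real line.\<close>
  have H_eq: "H \<xi> = exp (- ((of_real \<xi> - of_real a) / of_real L)\<^sup>2 / 2 + \<i> * of_real x * of_real \<xi>)" for \<xi>
    unfolding H_def gauss_def exp_add by (simp add: cis_conv_exp exp_of_real[symmetric] mult.assoc)
  have norm_H: "norm (H \<xi>) = gauss a L \<xi>" for \<xi>
    by (simp add: H_def norm_mult gauss_pos less_imp_le)
  have contH: "continuous_on X H" for X
    unfolding H_def gauss_def using L by (intro continuous_intros) auto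
  have deriv: "(H has_vector_derivative D \<xi> + \<i> * of_real x * H \<xi>) (at \<xi> within X)" for \<xi> X
    unfolding H_eq[abs_def] D_def
    by (rule has_vector_derivative_real_field)
       (use L in \<open>auto intro!: derivative_eq_intros simp: field_simps power2_eq_square\<close>)
  let ?I = "\<lambda>F. LINT \<xi>|lborel. indicator {c..d} \<xi> *\<^sub>R (F \<xi> :: complex)"
  have contD: "continuous_on X D" for X
    unfolding D_def using L by (intro continuous_intros contH) auto
  have int: "integrable lborel (\<lambda>\<xi>. indicator {c..d} \<xi> *\<^sub>R F \<xi>)"
    if "continuous_on {c..d} F" for F :: "real \<Rightarrow> complex"
    using borel_integrable_atLeastAtMost'[OF that] by (simp add: set_integrable_def)
  have "?I (\<lambda>\<xi>. D \<xi> + \<i> * of_real x * H \<xi>) = H d - H c"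
    by (rule integral_FTC_atLeastAtMost)
       (use assms deriv in \<open>auto intro!: continuous_intros contH contD\<close>)
  moreover have "?I (\<lambda>\<xi>. D \<xi> + \<i> * of_real x * H \<xi>) = ?I D + ?I (\<lambda>\<xi>. \<i> * of_real x * H \<xi>)"
    unfolding scaleR_add_right
    by (intro Bochner_Integration.integral_add int continuous_intros contH contD)
  moreover have "?I (\<lambda>\<xi>. \<i> * of_real x * H \<xi>) = \<i> * of_real x * ?I H"
    unfolding mult_scaleR_right[symmetric] by (rule integral_mult_right_zero)
  ultimately have eq: "\<i> * of_real x * ?I H = H d - H c - ?I D" by (simp add: algebra_simps)
  have "norm (?I D) \<le> (LINT \<xi>|lborel. (gauss a L \<xi> * \<bar>\<xi> - a\<bar>) / L\<^sup>2)"
  proof (rule Bochner_Integration.integral_norm_bound_integral[OF int[OF contD]])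
    show "integrable lborel (\<lambda>\<xi>. (gauss a L \<xi> * \<bar>\<xi> - a\<bar>) / L\<^sup>2)"
      using integrable_gauss_moment[OF L, of a 1] by simp
    show "norm (indicator {c..d} \<xi> *\<^sub>R D \<xi>) \<le> (gauss a L \<xi> * \<bar>\<xi> - a\<bar>) / L\<^sup>2" for \<xi>
      unfolding D_def
      by (auto simp: norm_mult norm_H norm_divide indicator_def gauss_pos less_imp_le norm_power
                mult.commute simp flip: of_real_diff)
  qed
  then have "norm (?I D) \<le> (LINT \<xi>|lborel. gauss a L \<xi> * \<bar>\<xi> - a\<bar>) / L\<^sup>2" by simp
  moreover have "norm (H d) \<le> 1" "norm (H c) \<le> 1" by (simp_all add: norm_H gauss_le_1)
  moreover have "norm (H d - H c - ?I D) \<le> norm (H d) + norm (H c) + norm (?I D)"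
    by (intro order_trans[OF norm_triangle_ineq4] add_mono norm_triangle_ineq4) auto
  moreover have "\<bar>x\<bar> * norm (?I H) = norm (H d - H c - ?I D)"
    unfolding eq[symmetric] by (simp add: norm_mult)
  moreover have "?I H = (LINT \<xi>|lborel. band a L {c..d} \<xi> * cis (x * \<xi>))"
    by (simp add: band_def H_def scaleR_conv_of_real mult.assoc)
  ultimately show ?thesis by simp
qed

text \<open>Together with boundedness, this puts \<open>S\<^sub>J f\<close> into \<open>L\<^sup>r\<close> for every \<open>r > 1\<close> without M. Riesz's theorem.\<close>

lemma band_integral_decay:
  assumes L: "0 < L" and J: "open J" "connected J"
  shows "\<bar>x\<bar> * norm (LINT \<xi>|lborel. band a L J \<xi> * cis (x * \<xi>))
    \<le> 2 + (LINT \<xi>|lborel. gauss a L \<xi> * \<bar>\<xi> - a\<bar>) / L\<^sup>2" (is "_ \<le> ?M")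
proof -
  have [measurable]: "J \<in> sets borel" using J by auto
  \<comment> \<open>\<open>J\<close> may be unbounded. Its truncations are bounded open intervals or
    empty, and the uniform bound for them survives the limit by dominated convergence.\<close>
  define T where "T n = J \<inter> {- real n<..<real n}" for n
  have [measurable]: "T n \<in> sets borel" for n unfolding T_def by measurable
  have M: "0 \<le> ?M" using L by (auto simp: gauss_pos less_imp_le)
  have le: "\<bar>x\<bar> * norm (LINT \<xi>|lborel. band a L (T n) \<xi> * cis (x * \<xi>)) \<le> ?M" for n
  proof (cases "T n = {}")
    case True
    then show ?thesis using M by (simp add: band_def)
  next
    case False
    moreover have "open (T n)" "connected (T n)" "bounded (T n)"
      using J by (auto simp: T_def simp flip: is_interval_connected_1
          intro!: is_interval_Int intro: bounded_subset[of "{- real n..real n}"])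
    ultimately obtain c d where cd: "c < d" "T n = {c<..<d}"
      using open_connected_bounded_real by metis
    have "(LINT \<xi>|lborel. band a L (T n) \<xi> * cis (x * \<xi>))
        = (LINT \<xi>|lborel. band a L {c..d} \<xi> * cis (x * \<xi>))"
    proof (rule integral_cong_AE)
      show "AE \<xi> in lborel. band a L (T n) \<xi> * cis (x * \<xi>) = band a L {c..d} \<xi> * cis (x * \<xi>)"
        using AE_lborel_singleton[of c] AE_lborel_singleton[of d]
        by eventually_elim (auto simp: band_def cd indicator_def)
    qed measurable
    then show ?thesis using band_integral_by_parts[OF L less_imp_le[OF cd(1)]] by simp
  qed
  have "(\<lambda>n. LINT \<xi>|lborel. band a L (T n) \<xi> * cis (x * \<xi>))
      \<longlonglongrightarrow> (LINT \<xi>|lborel. band a L J \<xi> * cis (x * \<xi>))"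
  proof (rule integral_dominated_convergence[OF _ _ integrable_gauss[OF L, of a]])
    show "AE \<xi> in lborel. (\<lambda>n. band a L (T n) \<xi> * cis (x * \<xi>)) \<longlonglongrightarrow> band a L J \<xi> * cis (x * \<xi>)"
    proof (rule AE_I2)
      fix \<xi> :: real
      obtain m where "\<bar>\<xi>\<bar> < real m" using reals_Archimedean2 by blast
      then have "band a L (T n) \<xi> * cis (x * \<xi>) = band a L J \<xi> * cis (x * \<xi>)" if "m \<le> n" for n
        using that by (auto simp: band_def T_def indicator_def)
      then show "(\<lambda>n. band a L (T n) \<xi> * cis (x * \<xi>)) \<longlonglongrightarrow> band a L J \<xi> * cis (x * \<xi>)"
        by (intro tendsto_eventually) (auto simp: eventually_sequentially)
    qed
    show "AE \<xi> in lborel. norm (band a L (T n) \<xi> * cis (x * \<xi>)) \<le> gauss a L \<xi>" for n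
      using norm_band_le_gauss by (auto simp: norm_mult)
  qed measurable
  then have "(\<lambda>n. \<bar>x\<bar> * norm (LINT \<xi>|lborel. band a L (T n) \<xi> * cis (x * \<xi>)))
      \<longlonglongrightarrow> \<bar>x\<bar> * norm (LINT \<xi>|lborel. band a L J \<xi> * cis (x * \<xi>))"
    by (intro tendsto_intros)
  then show ?thesis by (rule LIMSEQ_le_const2) (use le in auto)
qed

lemma inv_fourier_band_Lp:
  assumes L: "0 < L" and J: "open J" "connected J" and "1 < r"
  shows "inv_fourier (band a L J) \<in> Lp_space r"
proof (rule Lp_space_decay[OF _ _ \<open>1 < r\<close>])
  \<comment> \<open>\<open>M1\<close> bounds the integral and \<open>M2\<close> bounds
    \<open>\<bar>x\<bar>\<close> times it; the sum of the two bounds gives the factor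
    \<open>1 + \<bar>x\<bar>\<close>.\<close>
  define M1 where "M1 = (LINT \<xi>|lborel. gauss a L \<xi>)"
  define M2 where "M2 = 2 + (LINT \<xi>|lborel. gauss a L \<xi> * \<bar>\<xi> - a\<bar>) / L\<^sup>2"
  have [measurable]: "J \<in> sets borel" using J by auto
  show "inv_fourier (band a L J) \<in> borel_measurable borel" by measurable
  show "norm (inv_fourier (band a L J) x) \<le> (1 / (2 * pi) * (M1 + M2)) / (1 + \<bar>x\<bar>)" for x
  proof -
    let ?i = "LINT \<xi>|lborel. band a L J \<xi> * cis (x * \<xi>)"
    have "norm ?i \<le> M1"
      unfolding M1_def
      using integrable_band[OF L, of J a x] norm_band_le_gauss[of a L J]
      by (intro Bochner_Integration.integral_norm_bound_integral integrable_gauss L) (auto simp: norm_mult)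
    moreover have "\<bar>x\<bar> * norm ?i \<le> M2"
      unfolding M2_def by (rule band_integral_decay) fact+
    ultimately have "norm ?i \<le> (M1 + M2) / (1 + \<bar>x\<bar>)"
      by (simp add: pos_le_divide_eq add_pos_nonneg algebra_simps)
    from mult_left_mono[OF this, of "1 / (2 * pi)"] show ?thesis
      unfolding inv_fourier_def norm_mult by (simp add: norm_divide)
  qed
qed

text \<open>Jumps can occur only on the frontier of \<open>J\<close>, which is negligible because
  \<open>J\<close> is convex.\<close>

lemma AE_isCont_band:
  assumes "connected J" "0 < L"
  shows "AE \<xi> in lborel. isCont (band a L J) \<xi>"
proof -
  have "negligible (frontier J)"
    using assms by (intro negligible_convex_frontier) (simp add: connected_convex_1)
  then have "frontier J \<in> null_sets lborel"
    by (simp add: negligible_iff_null_sets null_sets_completion_iff)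
  then have "AE \<xi> in lborel. \<xi> \<notin> frontier J" by (rule AE_not_in)
  then show ?thesis
  proof eventually_elim
    case (elim \<xi>)
    then have "isCont (indicator J :: real \<Rightarrow> real) \<xi>" by (simp add: isCont_indicator)
    then show ?case
      unfolding band_def[abs_def] gauss_def[abs_def] using assms by (intro continuous_intros) auto
  qed
qed

lemma fourier_L2_band:
  assumes "0 < L" "open J" "connected J"
  shows "fourier_L2 (inv_fourier (band a L J)) (band a L J)"
  using assms
  by (intro fourier_L2_inv_fourier[OF _ band_quadratic_decay] AE_isCont_band inv_fourier_band_Lp) auto

text \<open>Both functions lie in the spaces of exponent 2 and \<open>p\<close>, so constant
  sequences witness the extension by continuity.\<close>

lemma freq_restrict_Lp_band:
  assumes "0 < L" "open J" "connected J" "1 < p"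
  shows "freq_restrict_Lp p J (inv_fourier (band a L UNIV)) (inv_fourier (band a L J))"
proof -
  let ?f = "inv_fourier (band a L UNIV)" and ?g = "inv_fourier (band a L J)"
  have f: "?f \<in> Lp_space r" and g: "?g \<in> Lp_space r" if "1 < r" for r
    using assms that by (auto intro!: inv_fourier_band_Lp)
  have "(\<lambda>\<xi>. of_real (indicator J \<xi>) * band a L UNIV \<xi>) = band a L J"
    by (simp add: band_def fun_eq_iff)
  then have "freq_restrict J ?f ?g"
    unfolding freq_restrict_def using assms
    by (intro exI[of _ "band a L UNIV"]) (auto intro!: fourier_L2_band)
  moreover have "Lp_tendsto p (\<lambda>n. h) h" if "h \<in> Lp_space p" for h
    using that by (simp add: Lp_tendsto_def Lp_norm_def)
  ultimately show ?thesis
    unfolding freq_restrict_Lp_def using f g \<open>1 < p\<close>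
    by (intro exI[of _ "\<lambda>n. ?f"] exI[of _ "\<lambda>n. ?g"]) auto
qed

text \<open>Centring the Gaussian at \<open>a\<close> only contributes a phase, so the modulus at
  \<open>x\<close> is \<open>L\<close> times the standard normal density at \<open>x * L\<close>.
  The dilation \<open>y = L * x\<close> then removes one power of \<open>L\<close>.\<close>

lemma Lp_integral_inv_fourier_gauss:
  assumes L: "0 < L"
  shows "(LINT x|lborel. norm (inv_fourier (band a L UNIV) x) powr p)
    = L powr (p - 1) * (LINT y|lborel. (exp (- y\<^sup>2 / 2) / sqrt (2 * pi)) powr p)"
proof -
  have norm_f: "norm (inv_fourier (band a L UNIV) x) = L * (exp (- (x * L)\<^sup>2 / 2) / sqrt (2 * pi))" for x
  proof -
    have "(LINT \<xi>|lborel. band a L UNIV \<xi> * cis (x * \<xi>))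
        = \<bar>1\<bar> *\<^sub>R (LINT \<xi>|lborel. band a L UNIV (a + 1 * \<xi>) * cis (x * (a + 1 * \<xi>)))"
      by (rule lborel_integral_real_affine) simp
    also have "\<dots> = (LINT \<xi>|lborel. cis (x * a) * (of_real (exp (- (\<xi> / L)\<^sup>2 / 2)) * cis (x * \<xi>)))"
      by (simp add: band_def gauss_def distrib_left mult_ac flip: cis_mult)
    also have "\<dots> = cis (x * a) * of_real (L * sqrt (2 * pi) * exp (- (x * L)\<^sup>2 / 2))"
      unfolding integral_mult_right_zero integral_gauss_cis[OF L] ..
    finally have "norm (inv_fourier (band a L UNIV) x)
        = 1 / (2 * pi) * (L * sqrt (2 * pi) * exp (- (x * L)\<^sup>2 / 2))"
      using L by (simp add: inv_fourier_def norm_mult norm_divide)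
    also have "\<dots> = L * (exp (- (x * L)\<^sup>2 / 2) * (sqrt (2 * pi) / (2 * pi)))" by simp
    also have "sqrt (2 * pi) / (2 * pi) = 1 / sqrt (2 * pi)"
      by (simp add: field_simps flip: real_sqrt_mult)
    finally show ?thesis by simp
  qed
  let ?E = "\<lambda>y::real. (exp (- y\<^sup>2 / 2) / sqrt (2 * pi)) powr p"
  have "(LINT x|lborel. norm (inv_fourier (band a L UNIV) x) powr p) = (LINT x|lborel. L powr p * ?E (L * x))"
    unfolding norm_f using L by (simp only: powr_mult mult.commute[of _ L])
  also have "\<dots> = L powr p * (LINT x|lborel. ?E (0 + L * x))" by simp
  also have "(LINT x|lborel. ?E (0 + L * x)) = (LINT y|lborel. ?E y) / L"
    using lborel_integral_real_affine[of L ?E 0] L by simp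
  finally show ?thesis using L by (simp add: powr_diff)
qed

text \<open>Once the phase at \<open>c\<close> is divided out, the remaining phase
  \<open>x * (\<xi> - c)\<close> stays in \<open>[-1, 1]\<close>, where the cosine is at least
  \<open>cos 1 > 0\<close>, and the Gaussian is at least \<open>exp (- 1 / 2)\<close> on
  \<open>{a..a + L}\<close>. Hence the real parts add up without cancellation.\<close>

lemma inv_fourier_band_lower:
  assumes J: "{c<..<d} \<subseteq> {a..a + L}" and cd: "c < d" and x: "\<bar>x\<bar> * (d - c) \<le> 1"
  shows "exp (- 1 / 2) * cos 1 / (2 * pi) * (d - c) \<le> norm (inv_fourier (band a L {c<..<d}) x)"
proof -
  have L: "0 < L"
  proof -
    \<comment> \<open>Two distinct points of the interval lie in \<open>{a..a + L}\<close>, which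
      forces \<open>L\<close> to be positive.\<close>
    have "(c + d) / 2 \<in> {c<..<d}" "(c + 2 * d) / 3 \<in> {c<..<d}" using cd by auto
    with J have "(c + d) / 2 \<in> {a..a + L}" "(c + 2 * d) / 3 \<in> {a..a + L}" by blast+
    then show ?thesis using cd by simp
  qed
  let ?J = "{c<..<d}"
  have cos1: "0 < cos (1::real)" by (rule cos_gt_zero) (use pi_gt3 in auto)
  have "(LINT \<xi>|lborel. exp (- 1 / 2) * cos 1 * indicator ?J \<xi>)
      \<le> (LINT \<xi>|lborel. Re (cis (- (x * c)) * (band a L ?J \<xi> * cis (x * \<xi>))))"
  proof (rule integral_mono)
    show "integrable lborel (\<lambda>\<xi>. exp (- 1 / 2) * cos 1 * indicat_real ?J \<xi>)"
      using cd by (intro integrable_mult_right) simp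
    show "integrable lborel (\<lambda>\<xi>. Re (cis (- (x * c)) * (band a L ?J \<xi> * cis (x * \<xi>))))"
      by (intro integrable_Re integrable_mult_right integrable_band L) auto
    show "exp (- 1 / 2) * cos 1 * indicator ?J \<xi> \<le> Re (cis (- (x * c)) * (band a L ?J \<xi> * cis (x * \<xi>)))" for \<xi>
    proof (cases "\<xi> \<in> ?J")
      case True
      then have "\<bar>\<xi> - a\<bar> \<le> L" using J by auto
      then have "\<bar>(\<xi> - a) / L\<bar> \<le> 1" using L by simp
      then have "((\<xi> - a) / L)\<^sup>2 \<le> 1" by (simp add: abs_square_le_1)
      then have g: "exp (- 1 / 2) \<le> gauss a L \<xi>" by (simp add: gauss_def)
      have "\<bar>x * (\<xi> - c)\<bar> \<le> \<bar>x\<bar> * (d - c)"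
        using True by (auto simp: abs_mult intro!: mult_left_mono)
      with x have "cos 1 \<le> cos \<bar>x * (\<xi> - c)\<bar>"
        using pi_gt3 by (intro cos_monotone_0_pi_le) auto
      then have c: "cos 1 \<le> cos (x * (\<xi> - c))" by simp
      have "cis (- (x * c)) * (band a L ?J \<xi> * cis (x * \<xi>)) = of_real (gauss a L \<xi>) * cis (x * (\<xi> - c))"
        using True by (simp add: band_def cis_mult algebra_simps)
      then have "Re (cis (- (x * c)) * (band a L ?J \<xi> * cis (x * \<xi>))) = gauss a L \<xi> * cos (x * (\<xi> - c))"
        by simp
      then show ?thesis using True mult_mono[OF g c] cos1 gauss_pos[of a L \<xi>] by simp
    qed (simp add: band_def)
  qed
  also have "\<dots> = Re (cis (- (x * c)) * (LINT \<xi>|lborel. band a L ?J \<xi> * cis (x * \<xi>)))"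
    by (subst integral_Re) (auto intro!: integrable_mult_right integrable_band L)
  also have "\<dots> \<le> norm (LINT \<xi>|lborel. band a L ?J \<xi> * cis (x * \<xi>))"
    by (rule order_trans[OF complex_Re_le_cmod]) (simp add: norm_mult)
  finally have "exp (- 1 / 2) * cos 1 * (d - c) \<le> norm (LINT \<xi>|lborel. band a L ?J \<xi> * cis (x * \<xi>))"
    using cd by simp
  from mult_left_mono[OF this, of "1 / (2 * pi)"] show ?thesis
    unfolding inv_fourier_def norm_mult by (simp add: norm_divide)
qed

section \<open>Lengths of the complementary intervals\<close>

text \<open>Let \<open>A\<close> be the sum of squares. The square function of \<open>f\<close> is
  at least \<open>\<kappa> * sqrt A\<close> on \<open>{0..1 / t}\<close>, so its norm is at least
  \<open>\<kappa> * sqrt A * t powr (- 1 / p)\<close>. Comparison with the norm of \<open>f\<close>,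
  a multiple of \<open>L powr (1 / q)\<close>, and squaring give the bound. The constant involves
  only \<open>c2\<close>, \<open>\<kappa>\<close> and the Gaussian integral \<open>W\<close>, so it
  is the same for all positions, scales and finite families.\<close>

lemma square_sum_le_of_LP_property:
  fixes E :: "real set"
  assumes p: "1 < p" and q: "1 / p + 1 / q = 1" and E: "closed E" and LP: "LP_property p E"
  obtains B where "0 \<le> B"
    "\<And>a L t F. \<lbrakk>0 < L; 0 < t; finite F; F \<subseteq> components (- E);
        \<And>J. J \<in> F \<Longrightarrow> \<exists>c d. c < d \<and> J = {c<..<d} \<and> J \<subseteq> {a..a + L} \<and> d - c \<le> t\<rbrakk>
      \<Longrightarrow> (\<Sum>J\<in>F. (measure lborel J)\<^sup>2) \<le> B * L powr (2 / q) * t powr (2 / p)"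
proof -
  from LP obtain c2 where c2: "0 < c2" and
    upper: "\<And>f g. f \<in> Lp_space p \<Longrightarrow> (\<And>J. J \<in> components (- E) \<Longrightarrow> freq_restrict_Lp p J f (g J)) \<Longrightarrow>
          (AE x in lborel. (\<lambda>J. (norm (g J x))\<^sup>2) summable_on components (- E)) \<and>
          (\<lambda>x. of_real (square_function E g x)) \<in> Lp_space p \<and>
          Lp_norm p (\<lambda>x. of_real (square_function E g x)) \<le> c2 * Lp_norm p f"
    unfolding LP_property_def by blast
  define \<kappa> where "\<kappa> = exp (- 1 / 2) * cos (1::real) / (2 * pi)"
  have "0 < cos (1::real)" by (rule cos_gt_zero) (use pi_gt3 in auto)
  then have \<kappa>: "0 < \<kappa>" by (simp add: \<kappa>_def)
  define W where "W = (LINT y|lborel. (exp (- y\<^sup>2 / 2) / sqrt (2 * pi)) powr p)"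
  have W: "0 \<le> W" by (simp add: W_def)
  show thesis
  proof (rule that[of "(c2 / \<kappa>)\<^sup>2 * W powr (2 / p)"])
    show "0 \<le> (c2 / \<kappa>)\<^sup>2 * W powr (2 / p)" by simp
    fix a L t :: real and F
    assume L: "0 < L" and t: "0 < t" and F: "finite F" "F \<subseteq> components (- E)"
      and short: "\<And>J. J \<in> F \<Longrightarrow> \<exists>c d. c < d \<and> J = {c<..<d} \<and> J \<subseteq> {a..a + L} \<and> d - c \<le> t"
    define g where "g J = inv_fourier (band a L J)" for J
    define f where "f = g UNIV"
    define S where "S = square_function E g"
    define A where "A = (\<Sum>J\<in>F. (measure lborel J)\<^sup>2)"
    have A: "0 \<le> A" by (simp add: A_def sum_nonneg)
    have f: "f \<in> Lp_space p"
      unfolding f_def g_def by (rule inv_fourier_band_Lp) (use L p in auto)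
    have fr: "freq_restrict_Lp p J f (g J)" if "J \<in> components (- E)" for J
      unfolding f_def g_def
      using that E L p by (intro freq_restrict_Lp_band) (auto intro: open_components in_components_connected)
    from upper[OF f fr] have summable: "AE x in lborel. (\<lambda>J. (norm (g J x))\<^sup>2) summable_on components (- E)"
      and S: "(\<lambda>x. of_real (S x)) \<in> Lp_space p" and
      norm_S: "Lp_norm p (\<lambda>x. of_real (S x)) \<le> c2 * Lp_norm p f"
      unfolding S_def by auto
    have g_lower: "\<kappa> * measure lborel J \<le> norm (g J x)" if "J \<in> F" "x \<in> {0..1 / t}" for J x
    proof -
      from short[OF that(1)] obtain c d where cd: "c < d" "J = {c<..<d}" "J \<subseteq> {a..a + L}" "d - c \<le> t"
        by blast
      have "\<bar>x\<bar> * (d - c) \<le> (1 / t) * t"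
        using that cd t by (intro mult_mono) auto
      then have "\<bar>x\<bar> * (d - c) \<le> 1" using t by simp
      from inv_fourier_band_lower[OF _ cd(1) this, of a L] cd show ?thesis
        by (simp add: \<kappa>_def g_def)
    qed
    have "AE x in lborel. indicator {0..1 / t} x * (\<kappa> * sqrt A) powr p \<le> norm (complex_of_real (S x)) powr p"
      using summable
    proof eventually_elim
      case (elim x)
      show ?case
      proof (cases "x \<in> {0..1 / t}")
        case True
        have "\<kappa>\<^sup>2 * A \<le> (\<Sum>J\<in>F. (norm (g J x))\<^sup>2)"
          unfolding A_def sum_distrib_left power_mult_distrib[symmetric]
          using g_lower[OF _ True] \<kappa> by (intro sum_mono power_mono) auto
        \<comment> \<open>Summability at \<open>x\<close> matters here: where it fails, the infinite
          sum takes the default value 0 and dominates no partial sum of positive terms.\<close>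
        also have "\<dots> \<le> (\<Sum>\<^sub>\<infinity>J\<in>components (- E). (norm (g J x))\<^sup>2)"
          by (rule finite_sum_le_infsum[OF elim F]) auto
        finally have "sqrt (\<kappa>\<^sup>2 * A) \<le> S x"
          unfolding S_def square_function_def by (rule real_sqrt_le_mono)
        then have "\<kappa> * sqrt A \<le> S x"
          using \<kappa> by (simp add: real_sqrt_mult)
        moreover have "0 \<le> \<kappa> * sqrt A" using \<kappa> A by simp
        ultimately show ?thesis using True p by (auto intro!: powr_mono2)
      qed simp
    qed
    then have "(LINT x|lborel. indicator {0..1 / t} x * (\<kappa> * sqrt A) powr p) \<le> (LINT x|lborel. norm (complex_of_real (S x)) powr p)"
    proof (intro integral_mono_AE)
      show "integrable lborel (\<lambda>x. indicator {0..1 / t} x * (\<kappa> * sqrt A) powr p)"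
        using t by (intro integrable_mult_left) simp
      show "integrable lborel (\<lambda>x. norm (complex_of_real (S x)) powr p)"
        using S by (simp add: Lp_space_def)
    qed
    then have "(1 / t) * (\<kappa> * sqrt A) powr p \<le> (LINT x|lborel. norm (complex_of_real (S x)) powr p)"
      using t by simp
    then have "((1 / t) * (\<kappa> * sqrt A) powr p) powr (1 / p) \<le> Lp_norm p (\<lambda>x. of_real (S x))"
      unfolding Lp_norm_def using t p by (intro powr_mono2) auto
    also note norm_S
    also have "Lp_norm p f = (L powr (p - 1) * W) powr (1 / p)"
      unfolding Lp_norm_def f_def g_def Lp_integral_inv_fourier_gauss[OF L] W_def ..
    finally have "((1 / t) * (\<kappa> * sqrt A) powr p) powr (1 / p) \<le> c2 * (L powr (p - 1) * W) powr (1 / p)" .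
    moreover have "((1 / t) * y powr p) powr (1 / p) = (1 / t) powr (1 / p) * y" if "0 \<le> y" for y
      using that p by (subst powr_mult) (simp add: powr_powr)
    moreover have "(L powr (p - 1) * W) powr (1 / p) = L powr ((p - 1) / p) * W powr (1 / p)"
      by (simp add: powr_mult powr_powr)
    ultimately have "(1 / t) powr (1 / p) * (\<kappa> * sqrt A) \<le> c2 * (L powr ((p - 1) / p) * W powr (1 / p))"
      using \<kappa> A by simp
    then have "\<kappa> * sqrt A \<le> c2 * (L powr ((p - 1) / p) * W powr (1 / p)) * t powr (1 / p)"
      using t by (simp add: powr_divide field_simps)
    then have "sqrt A \<le> c2 / \<kappa> * (L powr ((p - 1) / p) * W powr (1 / p) * t powr (1 / p))"
      using \<kappa> by (simp add: field_simps)
    then have "(sqrt A)\<^sup>2 \<le> (c2 / \<kappa> * (L powr ((p - 1) / p) * W powr (1 / p) * t powr (1 / p)))\<^sup>2"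
      using A by (intro power_mono) auto
    then have "A \<le> (c2 / \<kappa>)\<^sup>2 * ((L powr ((p - 1) / p))\<^sup>2 * (W powr (1 / p))\<^sup>2 * (t powr (1 / p))\<^sup>2)"
      using A by (simp only: power_mult_distrib real_sqrt_pow2)
    moreover have sq: "(y powr s)\<^sup>2 = y powr (2 * s)" for y s :: real
      by (simp add: power2_eq_square flip: powr_add)
    moreover have "2 * ((p - 1) / p) = 2 / q"
    proof -
      have "1 / q = 1 - 1 / p" using q by simp
      then have "2 / q = 2 * (1 - 1 / p)" by simp
      then show ?thesis using p by (simp add: diff_divide_distrib)
    qed
    ultimately show "A \<le> (c2 / \<kappa>)\<^sup>2 * W powr (2 / p) * L powr (2 / q) * t powr (2 / p)"
      by (simp add: mult_ac)
  qed
qed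

text \<open>The hypothesis at scale \<open>t\<close> is integrated against
  \<open>min 1 (\<delta> / t) / t\<^sup>2\<close>. Convergence at 0 needs
  \<open>\<alpha> > 1\<close> and convergence at infinity needs \<open>\<alpha> < 2\<close>; the two
  integrals produce the two reciprocals in the constant.\<close>

lemma sum_min_le_of_square_sums:
  fixes l :: "'a \<Rightarrow> real"
  assumes F: "finite F" and l: "\<And>j. j \<in> F \<Longrightarrow> 0 < l j" and \<alpha>: "1 < \<alpha>" "\<alpha> < 2" and M: "0 \<le> M" and \<delta>: "0 < \<delta>"
    and sq: "\<And>t. 0 < t \<Longrightarrow> (\<Sum>j | j \<in> F \<and> l j \<le> t. (l j)\<^sup>2) \<le> M * t powr \<alpha>"
  shows "(\<Sum>j\<in>F. min (l j) \<delta>) \<le> 8 * (1 / (\<alpha> - 1) + 1 / (2 - \<alpha>)) * M * \<delta> powr (\<alpha> - 1)"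
proof -
  \<comment> \<open>\<open>\<kappa> j\<close> is at most \<open>(l j)\<^sup>2\<close> times the weight on \<open>[l j, 2 l j]\<close>, and \<open>min (l j) \<delta> \<le> 8 \<kappa> j l j\<close>.\<close>
  define \<kappa> where "\<kappa> j = min 1 (\<delta> / (2 * l j)) / 4" for j
  \<comment> \<open>For positive \<open>t\<close>, this is \<open>M * t powr \<alpha>\<close> times
    the weight, split at \<open>\<delta>\<close>. At \<open>t = \<delta>\<close> both pieces count,
    which is harmless in an upper bound.\<close>
  define U where "U t = (if t \<in> {0..\<delta>} then M * t powr (\<alpha> - 2) else 0)
      + (if t \<in> {\<delta>..} then M * \<delta> * t powr (\<alpha> - 3) else 0)" for t
  define V where "V t = (\<Sum>j\<in>F. if t \<in> {l j..2 * l j} then \<kappa> j else 0)" for t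
  have "(V has_integral (\<Sum>j\<in>F. l j * \<kappa> j)) UNIV"
    unfolding V_def
  proof (intro has_integral_sum F)
    fix j assume "j \<in> F"
    have "((\<lambda>t. \<kappa> j) has_integral (2 * l j - l j) *\<^sub>R \<kappa> j) {l j..2 * l j}"
      using l[OF \<open>j \<in> F\<close>] by (intro has_integral_const_real[THEN has_integral_eq_rhs]) auto
    then show "((\<lambda>t. if t \<in> {l j..2 * l j} then \<kappa> j else 0) has_integral l j * \<kappa> j) UNIV"
      by (simp only: has_integral_restrict_UNIV) simp
  qed
  moreover have "(U has_integral (M * (\<delta> powr (\<alpha> - 1) / (\<alpha> - 1)) + M * \<delta> * (\<delta> powr (\<alpha> - 2) / (2 - \<alpha>)))) UNIV"
    unfolding U_def
  proof (rule has_integral_add; subst has_integral_restrict_UNIV; rule has_integral_mult_right)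
    show "((\<lambda>t. t powr (\<alpha> - 2)) has_integral \<delta> powr (\<alpha> - 1) / (\<alpha> - 1)) {0..\<delta>}"
      using has_integral_powr_from_0[of "\<alpha> - 2" \<delta>] \<alpha> \<delta> by (simp add: algebra_simps)
    have "- (\<delta> powr (\<alpha> - 2)) / (\<alpha> - 2) = \<delta> powr (\<alpha> - 2) / (2 - \<alpha>)"
      using \<alpha> by (simp add: field_simps)
    then show "((\<lambda>t. t powr (\<alpha> - 3)) has_integral \<delta> powr (\<alpha> - 2) / (2 - \<alpha>)) {\<delta>..}"
      using has_integral_powr_to_inf[of "\<alpha> - 3" \<delta>] \<alpha> \<delta> by (simp add: algebra_simps)
  qed
  moreover have "V t \<le> U t" for t
  proof (cases "0 < t")
    case False
    then have "V t = 0" using l by (force simp: V_def intro!: sum.neutral)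
    moreover have "0 \<le> U t" using M \<delta> by (auto simp: U_def)
    ultimately show ?thesis by simp
  next
    case True
    have "V t \<le> (\<Sum>j\<in>F. if l j \<le> t then (l j)\<^sup>2 * (min 1 (\<delta> / t) / t\<^sup>2) else 0)"
      unfolding V_def
    proof (rule sum_mono)
      fix j assume j: "j \<in> F"
      note lj = l[OF j]
      show "(if t \<in> {l j..2 * l j} then \<kappa> j else 0) \<le> (if l j \<le> t then (l j)\<^sup>2 * (min 1 (\<delta> / t) / t\<^sup>2) else 0)"
      proof (cases "t \<in> {l j..2 * l j}")
        case True
        \<comment> \<open>From \<open>t \<le> 2 * l j\<close> come both
          \<open>\<delta> / (2 * l j) \<le> \<delta> / t\<close> and
          \<open>1 / 4 \<le> (l j / t)\<^sup>2\<close>, one for each factor of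
          \<open>\<kappa> j\<close>.\<close>
        have "min 1 (\<delta> / (2 * l j)) \<le> min 1 (\<delta> / t)"
          using True lj \<delta> \<open>0 < t\<close> by (intro min.mono divide_left_mono) auto
        moreover have "1 / 4 \<le> (l j)\<^sup>2 / t\<^sup>2"
        proof -
          have "t\<^sup>2 \<le> (2 * l j)\<^sup>2" using True \<open>0 < t\<close> by (intro power_mono) auto
          then show ?thesis using \<open>0 < t\<close> by (simp add: field_simps)
        qed
        ultimately have "min 1 (\<delta> / (2 * l j)) * (1 / 4) \<le> min 1 (\<delta> / t) * ((l j)\<^sup>2 / t\<^sup>2)"
          using \<delta> lj \<open>0 < t\<close> by (intro mult_mono) auto
        then show ?thesis using True by (simp add: \<kappa>_def mult_ac)
      next
        case False
        then show ?thesis using \<delta> \<open>0 < t\<close> by auto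
      qed
    qed
    also have "\<dots> = (\<Sum>j | j \<in> F \<and> l j \<le> t. (l j)\<^sup>2) * (min 1 (\<delta> / t) / t\<^sup>2)"
      unfolding sum_distrib_right by (simp only: sum.inter_filter[OF F])
    also have "\<dots> \<le> M * t powr \<alpha> * (min 1 (\<delta> / t) / t\<^sup>2)"
      using sq[OF True] \<delta> True by (intro mult_right_mono) auto
    also have "\<dots> \<le> U t"
    proof (cases "t \<le> \<delta>")
      case le: True
      have "M * t powr \<alpha> * (min 1 (\<delta> / t) / t\<^sup>2) = M * t powr (\<alpha> - 2)"
        using le True by (simp add: powr_diff min_def)
      also have "\<dots> \<le> U t" using le True M \<delta> by (auto simp: U_def)
      finally show ?thesis .
    next
      case gt: False
      have "M * t powr \<alpha> * (min 1 (\<delta> / t) / t\<^sup>2) = M * \<delta> * t powr (\<alpha> - 3)"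
        using gt True by (simp add: powr_diff min_def power2_eq_square power3_eq_cube mult_ac)
      also have "\<dots> \<le> U t" using gt True M \<delta> by (auto simp: U_def)
      finally show ?thesis .
    qed
    finally show ?thesis .
  qed
  ultimately have "(\<Sum>j\<in>F. l j * \<kappa> j) \<le> M * (\<delta> powr (\<alpha> - 1) / (\<alpha> - 1)) + M * \<delta> * (\<delta> powr (\<alpha> - 2) / (2 - \<alpha>))"
    by (rule has_integral_le) 
  also have "\<delta> * \<delta> powr (\<alpha> - 2) = \<delta> powr (\<alpha> - 1)"
    using \<delta> powr_add[of \<delta> 1 "\<alpha> - 2"] by simp
  then have "M * (\<delta> powr (\<alpha> - 1) / (\<alpha> - 1)) + M * \<delta> * (\<delta> powr (\<alpha> - 2) / (2 - \<alpha>))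
     = (1 / (\<alpha> - 1) + 1 / (2 - \<alpha>)) * M * \<delta> powr (\<alpha> - 1)"
    by (simp add: distrib_right mult.assoc)
  finally have le: "(\<Sum>j\<in>F. l j * \<kappa> j) \<le> (1 / (\<alpha> - 1) + 1 / (2 - \<alpha>)) * M * \<delta> powr (\<alpha> - 1)" .
  \<comment> \<open>The factor 8 undoes the normalisation: \<open>8 * (l j * \<kappa> j)\<close>
    equals \<open>min (2 * l j) \<delta>\<close>.\<close>
  have "(\<Sum>j\<in>F. min (l j) \<delta>) \<le> (\<Sum>j\<in>F. 8 * (l j * \<kappa> j))"
  proof (rule sum_mono)
    fix j assume "j \<in> F"
    then show "min (l j) \<delta> \<le> 8 * (l j * \<kappa> j)"
      using l[of j] \<delta> by (auto simp: \<kappa>_def min_def field_simps)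
  qed
  also have "\<dots> = 8 * (\<Sum>j\<in>F. l j * \<kappa> j)" by (simp add: sum_distrib_left)
  also have "\<dots> \<le> 8 * ((1 / (\<alpha> - 1) + 1 / (2 - \<alpha>)) * M * \<delta> powr (\<alpha> - 1))"
    by (intro mult_left_mono le) simp
  finally show ?thesis by (simp only: mult.assoc)
qed

text \<open>Continuity from below along an enumeration of \<open>C\<close>, with subadditivity on
  each initial segment. This lets all earlier estimates be stated for finite families.\<close>

lemma emeasure_UN_le_finite_sums:
  assumes C: "countable C" and X: "\<And>j. j \<in> C \<Longrightarrow> X j \<in> sets M"
    and le: "\<And>F. finite F \<Longrightarrow> F \<subseteq> C \<Longrightarrow> (\<Sum>j\<in>F. emeasure M (X j)) \<le> B"
  shows "emeasure M (\<Union>j\<in>C. X j) \<le> B"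
proof (cases "C = {}")
  case False
  define D where "D n = (\<Union>j\<in>from_nat_into C ` {..n}. X j)" for n
  have sub: "from_nat_into C ` {..n} \<subseteq> C" for n
    using from_nat_into[OF False] by auto
  have "(\<Union>j\<in>C. X j) = (\<Union>n. D n)"
    using sub from_nat_into_surj[OF C] by (fastforce simp: D_def)
  moreover have "(SUP n. emeasure M (D n)) = emeasure M (\<Union>n. D n)"
  proof (rule SUP_emeasure_incseq)
    show "range D \<subseteq> sets M"
      unfolding D_def using X sub by (auto intro!: sets.finite_UN)
    show "incseq D"
      unfolding incseq_def D_def by (intro allI impI UN_mono image_mono) auto
  qed
  moreover have "emeasure M (D n) \<le> B" for n
    unfolding D_def
    by (rule order_trans[OF emeasure_subadditive_finite le]) (use X sub in auto)
  ultimately show ?thesis by (metis SUP_least)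
qed simp

section \<open>Neighbourhoods of portions\<close>

lemma countable_components_open:
  fixes S :: "'a::{second_countable_topology, real_normed_vector} set"
  assumes "open S"
  shows "countable (components S)"
proof (rule countable_disjoint_open_subsets)
  show "open J" if "J \<in> components S" for J using assms that by (rule open_components)
  show "pairwise disjnt (components S)"
    unfolding pairwise_def disjnt_def by (metis components_nonoverlap)
qed

lemma open_nbhd: "open (nbhd \<delta> F)"
  unfolding nbhd_def by auto

text \<open>\<open>A\<close> misses the interval, so the segment from a point of the interval to a
  nearby point of \<open>A\<close> passes an endpoint. Only the strips of width
  \<open>\<delta>\<close> at the two ends can be reached.\<close>

lemma nbhd_inter_component_le:
  fixes A :: "real set"
  assumes "c < d" "{c<..<d} \<inter> A = {}" "0 < \<delta>"
  shows "emeasure lborel ({c<..<d} \<inter> nbhd \<delta> A) \<le> ennreal (min (d - c) (2 * \<delta>))"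
proof -
  have "emeasure lborel ({c<..<d} \<inter> nbhd \<delta> A) \<le> emeasure lborel {c<..<d}"
    by (intro emeasure_mono) auto
  then have 1: "emeasure lborel ({c<..<d} \<inter> nbhd \<delta> A) \<le> ennreal (d - c)"
    using assms by simp
  have "{c<..<d} \<inter> nbhd \<delta> A \<subseteq> {c..c + \<delta>} \<union> {d - \<delta>..d}"
  proof
    fix x assume x: "x \<in> {c<..<d} \<inter> nbhd \<delta> A"
    then obtain y where y: "y \<in> A" "\<bar>y - x\<bar> < \<delta>" by (auto simp: nbhd_def dist_real_def)
    then have "y \<notin> {c<..<d}" using assms by auto
    with x y show "x \<in> {c..c + \<delta>} \<union> {d - \<delta>..d}" by auto
  qed
  then have "emeasure lborel ({c<..<d} \<inter> nbhd \<delta> A) \<le> emeasure lborel ({c..c + \<delta>} \<union> {d - \<delta>..d})"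
    by (intro emeasure_mono) auto
  also have "\<dots> \<le> emeasure lborel {c..c + \<delta>} + emeasure lborel {d - \<delta>..d}"
    by (intro emeasure_subadditive) auto
  also have "\<dots> = ennreal (2 * \<delta>)" using assms by (simp flip: ennreal_plus)
  finally have 2: "emeasure lborel ({c<..<d} \<inter> nbhd \<delta> A) \<le> ennreal (2 * \<delta>)" .
  from 1 2 show ?thesis by (simp add: min_def)
qed

text \<open>
  Shrinking \<open>I\<close> to \<open>[m, M]\<close>, whose endpoints belong to \<open>E\<close>, leaves no complementary interval
  that meets it only partially.
\<close>

lemma nbhd_portion_subset:
  fixes E I :: "real set"
  assumes E: "closed E" and I: "bounded I" "E \<inter> I \<noteq> {}"
  defines "m \<equiv> Inf (E \<inter> I)" and "M \<equiv> Sup (E \<inter> I)"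
  shows "nbhd \<delta> (E \<inter> I) \<subseteq> E \<union> {m - \<delta>..m} \<union> {M..M + \<delta>}
    \<union> (\<Union>J\<in>{J \<in> components (- E). J \<subseteq> {m<..<M}}. J \<inter> nbhd \<delta> (E \<inter> I))"
proof
  have bdd: "bdd_below (E \<inter> I)" "bdd_above (E \<inter> I)"
    using I bounded_subset[of I "E \<inter> I"] by (auto intro: bounded_imp_bdd_below bounded_imp_bdd_above)
  \<comment> \<open>\<open>m\<close> and \<open>M\<close> may lie outside \<open>I\<close>, but
    closedness keeps them in \<open>E\<close>.\<close>
  have "m \<in> closure (E \<inter> I)" "M \<in> closure (E \<inter> I)"
    unfolding m_def M_def using bdd I by (auto intro: closure_contains_Inf closure_contains_Sup)
  then have mM: "m \<in> E" "M \<in> E"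
    using closure_minimal[of "E \<inter> I" E] E by auto
  fix x assume x: "x \<in> nbhd \<delta> (E \<inter> I)"
  then obtain y where y: "y \<in> E \<inter> I" "\<bar>y - x\<bar> < \<delta>" by (auto simp: nbhd_def dist_real_def)
  then have my: "m \<le> y" "y \<le> M"
    unfolding m_def M_def using bdd by (auto intro: cInf_lower cSup_upper)
  show "x \<in> E \<union> {m - \<delta>..m} \<union> {M..M + \<delta>}
    \<union> (\<Union>J\<in>{J \<in> components (- E). J \<subseteq> {m<..<M}}. J \<inter> nbhd \<delta> (E \<inter> I))"
  proof (cases "x \<notin> E \<and> m < x \<and> x < M")
    case True
    \<comment> \<open>The component of \<open>x\<close> is an interval that avoids \<open>m\<close>
      and \<open>M\<close> and contains a point between them, so it cannot extend past
      either.\<close>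
    define J where "J = connected_component_set (- E) x"
    have J: "J \<in> components (- E)" "x \<in> J"
      using True by (auto simp: J_def components_def)
    have "is_interval J" using J by (simp add: is_interval_connected_1 in_components_connected)
    moreover have "m \<notin> J" "M \<notin> J" using in_components_subset[OF J(1)] mM by auto
    ultimately have "J \<subseteq> {m<..<M}"
      using True mem_is_interval_1_I[of J _ x m] mem_is_interval_1_I[of J x _ M] J(2)
      by (force simp flip: not_le)
    then show ?thesis using J x by blast
  qed (use my y in auto)
qed

text \<open>\<open>I\<close> contains every point strictly between its infimum and supremum, so
  their distance is at most the measure. This lets \<open>|I|\<close> serve as the width of the
  Gaussian.\<close>

lemma bounded_interval_subset_measure:
  fixes I :: "real set"
  assumes I: "is_interval I" "bounded I" and pos: "0 < measure lborel I"
  shows "I \<subseteq> {Inf I..Inf I + measure lborel I}"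
proof -
  have ne: "I \<noteq> {}" using pos by auto
  have bdd: "bdd_below I" "bdd_above I"
    using I by (auto intro: bounded_imp_bdd_below bounded_imp_bdd_above)
  have sub: "I \<subseteq> {Inf I..Sup I}" using bdd by (auto intro: cInf_lower cSup_upper)
  \<comment> \<open>\<open>measure\<close> is 0 on non-measurable sets, so a positive value implies
    measurability.\<close>
  have meas: "I \<in> sets lborel" using pos measure_notin_sets by fastforce
  have "{Inf I<..<Sup I} \<subseteq> I"
  proof
    fix x assume x: "x \<in> {Inf I<..<Sup I}"
    with bdd ne obtain y z where "y \<in> I" "y < x" "z \<in> I" "x < z"
      by (auto simp: cInf_less_iff less_cSup_iff)
    then show "x \<in> I" using I unfolding is_interval_1 by (meson less_imp_le)
  qed
  moreover have "emeasure lborel I \<noteq> \<infinity>"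
    using emeasure_mono[OF sub, of lborel] by (auto simp: top_unique emeasure_lborel_Icc_eq split: if_splits)
  ultimately have "measure lborel {Inf I<..<Sup I} \<le> measure lborel I"
    using meas by (intro measure_mono_fmeasurable) (auto simp: fmeasurable_def top.not_eq_extremum)
  moreover have "Inf I \<le> Sup I" using ne sub by fastforce
  ultimately show ?thesis using sub by auto
qed

section \<open>Adding up the null set, the end strips and the complementary intervals\<close>

theorem theorem2:
  fixes p q :: real and E :: "real set"
  assumes "1 < p" and "p < 2" and "1 / p + 1 / q = 1"
    and "closed E" and "E \<in> null_sets lborel"
    and "LP_property p E"
  shows "\<exists>c>0. \<forall>I \<delta>. is_interval I \<and> bounded I \<and> 0 < \<delta> \<and> \<delta> \<le> measure lborel I \<longrightarrow>
           measure lborel (nbhd \<delta> (E \<inter> I))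
             \<le> c * measure lborel I powr (2 / q) * \<delta> powr (1 - 2 / q)"
proof -
  note E = \<open>closed E\<close> and p = \<open>1 < p\<close> \<open>p < 2\<close>
  obtain B where B: "0 \<le> B" and squares:
    "\<And>a L t F. \<lbrakk>0 < L; 0 < t; finite F; F \<subseteq> components (- E);
        \<And>J. J \<in> F \<Longrightarrow> \<exists>c d. c < d \<and> J = {c<..<d} \<and> J \<subseteq> {a..a + L} \<and> d - c \<le> t\<rbrakk>
      \<Longrightarrow> (\<Sum>J\<in>F. (measure lborel J)\<^sup>2) \<le> B * L powr (2 / q) * t powr (2 / p)"
    by (rule square_sum_le_of_LP_property[OF p(1) assms(3) E assms(6)]) blast
  have qp: "1 - 2 / q = 2 / p - 1"
  proof -
    have "1 / q = 1 - 1 / p" using assms(3) by simp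
    then have "2 / q = 2 * (1 - 1 / p)" by simp
    then show ?thesis by simp
  qed
  \<comment> \<open>The range \<open>1 < p < 2\<close> places the exponent
    \<open>\<alpha> = 2 / p\<close> where the weighted integrals converge.\<close>
  have \<alpha>: "1 < 2 / p" "2 / p < 2" using p by (auto simp: field_simps)
  then have q0: "0 < 2 / q" using qp by linarith
  \<comment> \<open>The constant of \<open>sum_min_le_of_square_sums\<close> with
    \<open>M = B * L powr (2 / q)\<close> at threshold \<open>2 * \<delta>\<close>; the power of 2
    comes from that threshold.\<close>
  define k where "k = 8 * (1 / (2 / p - 1) + 1 / (2 - 2 / p)) * B * 2 powr (1 - 2 / q)"
  have k: "0 \<le> k" using \<alpha> B by (simp add: k_def)
  show ?thesis
  \<comment> \<open>The summand 2 pays for the strips of length \<open>\<delta>\<close> outside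
    \<open>m\<close> and \<open>M\<close>, and \<open>k\<close> for the complementary intervals
    between them.\<close>
  proof (intro exI[of _ "2 + k"] conjI allI impI)
    show "0 < 2 + k" using k by simp
    fix I :: "real set" and \<delta> :: real
    assume "is_interval I \<and> bounded I \<and> 0 < \<delta> \<and> \<delta> \<le> measure lborel I"
    then have I: "is_interval I" "bounded I" and \<delta>: "0 < \<delta>" "\<delta> \<le> measure lborel I" by auto
    define L where "L = measure lborel I"
    define R where "R = L powr (2 / q) * \<delta> powr (1 - 2 / q)"
    have L: "0 < L" "\<delta> \<le> L" using \<delta> by (auto simp: L_def)
    have R: "0 \<le> R" by (simp add: R_def)
    define N where "N = nbhd \<delta> (E \<inter> I)"
    have "measure lborel N \<le> (2 + k) * R"
    proof (cases "E \<inter> I = {}")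
      case True
      then show ?thesis using k R by (simp add: N_def nbhd_def)
    next
      case False
      define m where "m = Inf (E \<inter> I)"
      define M where "M = Sup (E \<inter> I)"
      define a where "a = Inf I"
      define C where "C = {J \<in> components (- E). J \<subseteq> {m<..<M}}"
      have sub: "I \<subseteq> {a..a + L}"
        unfolding a_def L_def using I L by (intro bounded_interval_subset_measure) (auto simp: L_def)
      have aL: "a \<le> m" "M \<le> a + L"
        unfolding m_def M_def using sub False by (auto intro!: cInf_greatest cSup_least)
      have C_interval: "\<exists>c d. c < d \<and> J = {c<..<d} \<and> J \<subseteq> {a..a + L}" if "J \<in> C" for J
      proof -
        have "J \<in> components (- E)" "J \<subseteq> {m<..<M}" using that by (auto simp: C_def)
        then have "open J" "connected J" "J \<noteq> {}" "bounded J"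
          using E by (auto dest: in_components_nonempty intro: open_components in_components_connected
              bounded_subset[of "{m<..<M}"])
        then obtain c d where "c < d" "J = {c<..<d}" using open_connected_bounded_real by metis
        moreover have "J \<subseteq> {a..a + L}" using \<open>J \<subseteq> {m<..<M}\<close> aL by auto
        ultimately show ?thesis by blast
      qed
      have countable: "countable C"
        by (rule countable_subset[OF _ countable_components_open[of "- E"]]) (use E in \<open>auto simp: C_def\<close>)
      have N[measurable]: "N \<in> sets borel" using open_nbhd by (simp add: N_def)
      have C_open: "open J" if "J \<in> C" for J using C_interval[OF that] by auto
      have UN_le: "emeasure lborel (\<Union>J\<in>C. J \<inter> N) \<le> ennreal (k * R)"
      proof (rule emeasure_UN_le_finite_sums[OF countable])
        show "J \<inter> N \<in> sets lborel" if "J \<in> C" for J using C_open[OF that] N by auto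
        fix F assume F: "finite F" "F \<subseteq> C"
        have pos: "0 < measure lborel J" if J: "J \<in> F" for J
        proof -
          from J F have "J \<in> C" by auto
          from C_interval[OF this] obtain c d where "c < d" "J = {c<..<d}" by blast
          then show ?thesis by simp
        qed
        have "(\<Sum>J\<in>F. emeasure lborel (J \<inter> N)) \<le> (\<Sum>J\<in>F. ennreal (min (measure lborel J) (2 * \<delta>)))"
        proof (rule sum_mono)
          fix J assume "J \<in> F"
          then have "J \<in> C" using F by auto
          from C_interval[OF this] obtain c d where cd: "c < d" "J = {c<..<d}" by blast
          moreover have "J \<inter> (E \<inter> I) = {}"
            using \<open>J \<in> C\<close> in_components_subset[of J "- E"] by (auto simp: C_def)
          ultimately show "emeasure lborel (J \<inter> N) \<le> ennreal (min (measure lborel J) (2 * \<delta>))"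
            using nbhd_inter_component_le[of c d "E \<inter> I" \<delta>] \<delta> by (simp add: N_def)
        qed
        also have "\<dots> = ennreal (\<Sum>J\<in>F. min (measure lborel J) (2 * \<delta>))"
          using \<delta> by (intro sum_ennreal) auto
        also have "(\<Sum>J\<in>F. min (measure lborel J) (2 * \<delta>))
            \<le> 8 * (1 / (2 / p - 1) + 1 / (2 - 2 / p)) * (B * L powr (2 / q)) * (2 * \<delta>) powr (2 / p - 1)"
        proof (rule sum_min_le_of_square_sums[OF F(1) pos \<alpha>])
          show "(\<Sum>J | J \<in> F \<and> measure lborel J \<le> t. (measure lborel J)\<^sup>2)
              \<le> B * L powr (2 / q) * t powr (2 / p)" if "0 < t" for t
          proof (rule squares[OF L(1) that])
            fix J assume J: "J \<in> {J. J \<in> F \<and> measure lborel J \<le> t}"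
            then have "J \<in> C" using F by auto
            from C_interval[OF this] obtain c d where cd: "c < d" "J = {c<..<d}" "J \<subseteq> {a..a + L}" by blast
            moreover from cd J have "d - c \<le> t" by simp
            ultimately show "\<exists>c d. c < d \<and> J = {c<..<d} \<and> J \<subseteq> {a..a + L} \<and> d - c \<le> t" by blast
          qed (use F in \<open>auto simp: C_def\<close>)
        qed (use B \<delta> in auto)
        also have "\<dots> = k * R"
          unfolding k_def R_def qp using \<delta> by (simp add: powr_mult mult_ac)
        finally show "(\<Sum>J\<in>F. emeasure lborel (J \<inter> N)) \<le> ennreal (k * R)" by (simp add: ennreal_leI)
      qed
      have meas: "(\<Union>J\<in>C. J \<inter> N) \<in> sets borel"
        using C_open N by (intro sets.countable_UN' countable) auto
      have "N \<subseteq> E \<union> {m - \<delta>..m} \<union> {M..M + \<delta>} \<union> (\<Union>J\<in>C. J \<inter> N)"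
        unfolding N_def C_def m_def M_def by (rule nbhd_portion_subset) fact+
      then have "emeasure lborel N \<le> emeasure lborel (E \<union> {m - \<delta>..m} \<union> {M..M + \<delta>} \<union> (\<Union>J\<in>C. J \<inter> N))"
        using E meas by (intro emeasure_mono) auto
      also have "\<dots> \<le> emeasure lborel E + emeasure lborel {m - \<delta>..m} + emeasure lborel {M..M + \<delta>}
          + emeasure lborel (\<Union>J\<in>C. J \<inter> N)"
        using E meas by (intro order_trans[OF emeasure_subadditive] add_right_mono) auto
      also have "\<dots> \<le> 0 + ennreal \<delta> + ennreal \<delta> + ennreal (k * R)"
        using \<open>E \<in> null_sets lborel\<close> \<delta> UN_le by (intro add_mono) auto
      also have "\<dots> = ennreal (2 * \<delta> + k * R)"
        using \<delta> k R by (simp flip: ennreal_plus)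
      finally have "measure lborel N \<le> 2 * \<delta> + k * R"
        using \<delta> k R unfolding measure_def by (intro enn2real_leI) auto
      \<comment> \<open>The restriction \<open>\<delta> \<le> |I|\<close> enters here: since
        \<open>2 / q\<close> is positive, \<open>\<delta> powr (2 / q) \<le> L powr (2 / q)\<close>,
        so the end strips are absorbed into \<open>R\<close>.\<close>
      also have "\<delta> \<le> R"
      proof -
        have "\<delta> = \<delta> powr (2 / q) * \<delta> powr (1 - 2 / q)" using \<delta> by (simp flip: powr_add)
        also have "\<dots> \<le> R" unfolding R_def using q0 \<delta> L by (intro mult_right_mono powr_mono2) auto
        finally show ?thesis .
      qed
      finally show ?thesis by (simp add: algebra_simps)
    qed
    then show "measure lborel (nbhd \<delta> (E \<inter> I))
        \<le> (2 + k) * measure lborel I powr (2 / q) * \<delta> powr (1 - 2 / q)"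
      by (simp add: N_def R_def L_def mult.assoc)
  qed
qed

end
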